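(* Let $d\ge 2$, $K\ge 1$ be integers, let $\mathcal{M}_K=(\mathbb{CP}^{d-1})^K$ be equipped with the product Fubini--Study metric (normalized as in the context), and let $E:\mathcal{M}_K\to\mathbb{R}$ be $C^2$. Suppose that $\boldsymbol{\phi}_*\in\mathcal{M}_K$ is a non-degenerate local minimum of $E$ with $$\lambda_*=\lambda_{\min}\left(\operatorname{Hess}_{\mathrm{FS}}E(\boldsymbol{\phi}_* )\right)>0 .$$ Then, for any $\mu\in(0,2\lambda_* )$, there exists a neighborhood $V$ of $\boldsymbol{\phi}_*$ such that, for every initial point $\boldsymbol{\phi}(0)\in V$, the nonlinear imaginary-time evolution (NITE) $\boldsymbol{\phi}(t)$ of $E$ starting at $\boldsymbol{\phi}(0)$ satisfies, for all $t\ge 0$, $$E(\boldsymbol{\phi}(t))-E(\boldsymbol{\phi}_* )\le e^{-\mu t}\left(E(\boldsymbol{\phi}(0))-E(\boldsymbol{\phi}_* )\right).$$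
   Context: Points of $\mathbb{CP}^{d-1}$ are represented by unit vectors $|\phi\rangle\in\mathbb{C}^d$ modulo global phase, and the tangent space at $[\phi]$ is identified with $\{\xi\in\mathbb{C}^d:\langle\phi|\xi\rangle=0\}$. The Fubini--Study metric is normalized as $g(\xi,\eta)=2\operatorname{Re}\langle\xi|\eta\rangle$, and $\mathcal{M}_K$ carries the product (sum) metric over the $K$ factors. $\operatorname{Hess}_{\mathrm{FS}}E$ is the Riemannian Hessian of $E$ for this metric, and $\lambda_{\min}$ is its smallest eigenvalue with respect to this metric, i.e. the largest $\lambda$ with $\operatorname{Hess}_{\mathrm{FS}}E[\xi,\xi]\ge\lambda\, g(\xi,\xi)$ for all tangent $\xi$. NITE is the gradient flow of $E$ in this metric: $\frac{d}{dt}\boldsymbol{\phi}(t)=-\nabla^{(\mathrm{FS})}E(\boldsymbol{\phi}(t))$. In terms of unit vectors, $\frac{d}{dt}|\phi_k\rangle=-(I-|\phi_k\rangle\langle\phi_k|)\frac{\delta E}{\delta\langle\phi_k|}$ for $k=1,\dots,K$, where $\frac{\delta E}{\delta\langle\phi_k|}$ is the Wirtinger derivative with respect to the bra variable; with the normalization $g(\xi,\eta)=2\operatorname{Re}\langle\xi|\eta\rangle$ the Riemannian gradient has components $(I-|\phi_k\rangle\langle\phi_k|)\frac{\delta E}{\delta\langle\phi_k|}$. For $K=1$ and $E(\phi)=\langle\phi|H|\phi\rangle$ with $H$ Hermitian, the flow is $\frac{d}{dt}|\phi\rangle=-(H-\langle\phi|H|\phi\rangle)|\phi\rangle$. *)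

theory Defs
  imports "HOL-Analysis.Analysis"
begin

section \<open>Complex projective space as unit vectors modulo phase\<close>

definition phase_equiv :: "complex ^ 'd \<Rightarrow> complex ^ 'd \<Rightarrow> bool" where
  "phase_equiv x y \<longleftrightarrow> norm x = 1 \<and> norm y = 1 \<and> (\<exists>c. norm c = 1 \<and> y = c *s x)"

lemma norm_vector_scalar_mult: "norm (c *s x) = norm c * norm (x :: complex ^ 'd)"
  by (simp add: norm_vec_def norm_mult L2_set_right_distrib)

lemma part_equivp_phase_equiv: "part_equivp (phase_equiv :: complex ^ 'd \<Rightarrow> _)"
proof (rule part_equivpI)
  have "phase_equiv (axis i 1) (axis i 1 :: complex ^ 'd)" for i
    unfolding phase_equiv_def by (auto intro!: exI[of _ 1] simp: norm_axis_1)
  then show "\<exists>x. phase_equiv x (x :: complex ^ 'd)" by blast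
  show "symp (phase_equiv :: complex ^ 'd \<Rightarrow> _)"
  proof (rule sympI)
    fix x y :: "complex ^ 'd"
    assume "phase_equiv x y"
    then obtain c where c: "norm c = 1" "y = c *s x" "norm x = 1" "norm y = 1"
      by (auto simp: phase_equiv_def)
    then have "inverse c * c = 1" by (metis left_inverse norm_zero zero_neq_one)
    then have "x = inverse c *s y" by (simp add: c(2) vector_smult_assoc)
    moreover have "norm (inverse c) = 1" by (simp add: norm_inverse c)
    ultimately show "phase_equiv y x" using c(3,4) unfolding phase_equiv_def by blast
  qed
  show "transp (phase_equiv :: complex ^ 'd \<Rightarrow> _)"
  proof (rule transpI)
    fix x y z :: "complex ^ 'd"
    assume "phase_equiv x y" "phase_equiv y z"
    then obtain c e where "norm c = 1" "y = c *s x" "norm e = 1" "z = e *s y"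
        "norm x = 1" "norm z = 1"
      by (auto simp: phase_equiv_def)
    then show "phase_equiv x z"
      unfolding phase_equiv_def
      by (auto intro!: exI[of _ "e * c"] simp: norm_mult vector_smult_assoc)
  qed
qed

text \<open>The type \<open>'d cproj\<close> is \<open>CP\<^sup>d\<^sup>-\<^sup>1\<close> with \<open>d = CARD('d)\<close>.
  It carries the quotient topology of the unit sphere.\<close>

quotient_type (overloaded) 'd cproj = "complex ^ ('d::finite)" / partial: phase_equiv
  by (rule part_equivp_phase_equiv)

instantiation cproj :: (finite) topological_space
begin

definition open_cproj :: "'a cproj set \<Rightarrow> bool" where
  "open_cproj U \<longleftrightarrow> openin (top_of_set (sphere 0 1)) {x \<in> sphere 0 1. abs_cproj x \<in> U}"

instance
proof
  show "open (UNIV :: 'a cproj set)"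
    by (simp add: open_cproj_def sphere_def)
next
  fix S T :: "'a cproj set"
  assume "open S" "open T"
  then have "openin (top_of_set (sphere 0 1))
      ({x \<in> sphere 0 1. abs_cproj x \<in> S} \<inter> {x \<in> sphere 0 1. abs_cproj x \<in> T})"
    unfolding open_cproj_def by (rule openin_Int)
  moreover have "{x \<in> sphere 0 1. abs_cproj x \<in> S} \<inter> {x \<in> sphere 0 1. abs_cproj x \<in> T}
      = {x \<in> sphere 0 1. abs_cproj x \<in> S \<inter> T}" by auto
  ultimately show "open (S \<inter> T)" by (simp only: open_cproj_def)
next
  fix \<K> :: "'a cproj set set"
  assume "\<forall>S\<in>\<K>. open S"
  then have "openin (top_of_set (sphere 0 1)) (\<Union>S\<in>\<K>. {x \<in> sphere 0 1. abs_cproj x \<in> S})"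
    unfolding open_cproj_def by (intro openin_Union) auto
  moreover have "(\<Union>S\<in>\<K>. {x \<in> sphere 0 1. abs_cproj x \<in> S})
      = {x \<in> sphere 0 1. abs_cproj x \<in> \<Union>\<K>}" by auto
  ultimately show "open (\<Union>\<K>)" by (simp only: open_cproj_def)
qed

end

text \<open>The manifold \<open>M\<^sub>K\<close> is the type \<open>'d cproj ^ 'k\<close> with \<open>K = CARD('k)\<close>, in the product
  topology. The map \<open>pt\<close> sends a tuple of nonzero vectors (not necessarily normalized) to the
  tuple of their rays.\<close>

definition pt :: "(complex ^ 'd) ^ 'k \<Rightarrow> ('d cproj) ^ 'k" where
  "pt \<psi> = (\<chi> k. abs_cproj (\<psi> $ k /\<^sub>R norm (\<psi> $ k)))"

definition unit_tuples :: "((complex ^ 'd) ^ 'k) set" where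
  "unit_tuples = {\<phi>. \<forall>k. norm (\<phi> $ k) = 1}"

definition nonzero_tuples :: "((complex ^ 'd) ^ 'k) set" where
  "nonzero_tuples = {\<psi>. \<forall>k. \<psi> $ k \<noteq> 0}"


section \<open>Differentiability\<close>

definition C2_on :: "'a::real_normed_vector set \<Rightarrow> ('a \<Rightarrow> real) \<Rightarrow> bool" where
  "C2_on S f \<longleftrightarrow>
     (\<exists>(f' :: 'a \<Rightarrow> 'a \<Rightarrow>\<^sub>L real) (f'' :: 'a \<Rightarrow> 'a \<Rightarrow>\<^sub>L ('a \<Rightarrow>\<^sub>L real)).
        (\<forall>x\<in>S. (f has_derivative blinfun_apply (f' x)) (at x)) \<and>
        (\<forall>x\<in>S. (f' has_derivative blinfun_apply (f'' x)) (at x)) \<and>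
        continuous_on S f'')"

text \<open>Since \<open>pt\<close> is a smooth surjective submersion from the open set of nonzero tuples onto
  \<open>M\<^sub>K\<close>, a function \<open>E\<close> on \<open>M\<^sub>K\<close> is \<open>C\<^sup>2\<close> iff its pullback \<open>E \<circ> pt\<close> is.\<close>

definition C2_manifold :: "(('d::finite) cproj ^ ('k::finite) \<Rightarrow> real) \<Rightarrow> bool" where
  "C2_manifold E \<longleftrightarrow> C2_on nonzero_tuples (E \<circ> pt)"


section \<open>Fubini--Study geometry\<close>

definition braket :: "complex ^ 'd \<Rightarrow> complex ^ 'd \<Rightarrow> complex" where
  "braket x y = (\<Sum>j\<in>UNIV. cnj (x $ j) * y $ j)"

definition tangent :: "(complex ^ 'd) ^ 'k \<Rightarrow> ((complex ^ 'd) ^ 'k) set" where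
  "tangent \<phi> = {\<xi>. \<forall>k. braket (\<phi> $ k) (\<xi> $ k) = 0}"

definition fs_metric :: "(complex ^ 'd) ^ 'k \<Rightarrow> (complex ^ 'd) ^ 'k \<Rightarrow> real" where
  "fs_metric \<xi> \<eta> = (\<Sum>k\<in>UNIV. 2 * Re (braket (\<xi> $ k) (\<eta> $ k)))"

text \<open>Componentwise application of the projections \<open>I - |\<phi>\<^sub>k\<rangle>\<langle>\<phi>\<^sub>k|\<close>.\<close>

definition hproj :: "(complex ^ 'd) ^ 'k \<Rightarrow> (complex ^ 'd) ^ 'k \<Rightarrow> (complex ^ 'd) ^ 'k" where
  "hproj \<phi> v = (\<chi> k. v $ k - braket (\<phi> $ k) (v $ k) *s \<phi> $ k)"

text \<open>The derivative with respect to the bras: the component at \<open>(k, j)\<close> is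
  \<open>\<partial>f/\<partial>z\<^sup>* = (\<partial>f/\<partial>x + \<i> \<partial>f/\<partial>y) / 2\<close> for the coordinate \<open>z = x + \<i> y = \<phi> $ k $ j\<close>.\<close>

definition wirtinger_bra ::
  "((complex ^ 'd) ^ 'k \<Rightarrow> real) \<Rightarrow> (complex ^ 'd) ^ 'k \<Rightarrow> (complex ^ 'd) ^ 'k" where
  "wirtinger_bra f \<phi> = (\<chi> k j.
     (of_real (frechet_derivative f (at \<phi>) (axis k (axis j 1)))
      + \<i> * of_real (frechet_derivative f (at \<phi>) (axis k (axis j \<i>)))) / 2)"

definition fs_grad ::
  "(('d::finite) cproj ^ ('k::finite) \<Rightarrow> real) \<Rightarrow> (complex ^ 'd) ^ 'k \<Rightarrow> (complex ^ 'd) ^ 'k" where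
  "fs_grad E \<phi> = hproj \<phi> (wirtinger_bra (E \<circ> pt) \<phi>)"

text \<open>At unit tuples, \<open>fs_grad\<close> is the Riemannian gradient.\<close>

lemma fs_grad_tangent:
  assumes "\<phi> \<in> unit_tuples"
  shows "fs_grad E \<phi> \<in> tangent \<phi>"
proof -
  have 1: "braket x x = 1" if "norm x = 1" for x :: "complex ^ 'a"
  proof -
    have "braket x x = of_real (\<Sum>j\<in>UNIV. (norm (x $ j))\<^sup>2)"
      unfolding braket_def of_real_sum
      by (intro sum.cong refl) (metis complex_norm_square mult.commute of_real_power)
    also have "(\<Sum>j\<in>UNIV. (norm (x $ j))\<^sup>2) = 1"
      using that by (simp add: norm_vec_def L2_set_def)
    finally show ?thesis by simp
  qed
  have 2: "braket x (v - c *s w) = braket x v - c * braket x w" for x v w :: "complex ^ 'a" and c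
    by (simp add: braket_def algebra_simps sum_subtractf sum_distrib_left)
  show ?thesis
    using assms by (auto simp: fs_grad_def hproj_def tangent_def unit_tuples_def 1 2)
qed

lemma fs_grad_represents_derivative:
  assumes "(E \<circ> pt) differentiable (at \<phi>)" and \<xi>: "\<xi> \<in> tangent \<phi>"
  shows "fs_metric (fs_grad E \<phi>) \<xi> = frechet_derivative (E \<circ> pt) (at \<phi>) \<xi>"
proof -
  define D where "D = frechet_derivative (E \<circ> pt) (at \<phi>)"
  define w where "w = wirtinger_bra (E \<circ> pt) \<phi>"
  have lin: "linear D"
    unfolding D_def using assms(1) by (rule linear_frechet_derivative)
  have dec: "\<xi> = (\<Sum>k\<in>UNIV. \<Sum>j\<in>UNIV. Re (\<xi> $ k $ j) *\<^sub>R axis k (axis j 1)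
      + Im (\<xi> $ k $ j) *\<^sub>R axis k (axis j \<i>))"
  proof -
    have "(\<Sum>k\<in>UNIV. \<Sum>j\<in>UNIV. Re (\<xi> $ k $ j) *\<^sub>R axis k (axis j 1)
        + Im (\<xi> $ k $ j) *\<^sub>R axis k (axis j \<i>)) $ a $ b = \<xi> $ a $ b" for a b
    proof -
      have "(\<Sum>k\<in>UNIV. \<Sum>j\<in>UNIV. Re (\<xi> $ k $ j) *\<^sub>R axis k (axis j 1)
          + Im (\<xi> $ k $ j) *\<^sub>R axis k (axis j \<i>)) $ a $ b
        = (\<Sum>k\<in>UNIV. \<Sum>j\<in>UNIV. if a = k then (if b = j then \<xi> $ k $ j else 0) else 0)"
        unfolding sum_component
        by (intro sum.cong refl) (auto simp: axis_def complex_eq_iff)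
      also have "\<dots> = (\<Sum>k\<in>UNIV. if a = k then (\<Sum>j\<in>UNIV. if b = j then \<xi> $ k $ j else 0) else 0)"
        by (intro sum.cong refl) auto
      also have "\<dots> = \<xi> $ a $ b" by simp
      finally show ?thesis .
    qed
    then show ?thesis by (simp add: vec_eq_iff)
  qed
  have "D \<xi> = (\<Sum>k\<in>UNIV. \<Sum>j\<in>UNIV. Re (\<xi> $ k $ j) * D (axis k (axis j 1))
      + Im (\<xi> $ k $ j) * D (axis k (axis j \<i>)))"
    by (subst dec) (simp add: linear_sum[OF lin] linear_add[OF lin] linear_scale[OF lin])
  also have "\<dots> = (\<Sum>k\<in>UNIV. \<Sum>j\<in>UNIV. 2 * Re (cnj (w $ k $ j) * \<xi> $ k $ j))"
    unfolding w_def D_def wirtinger_bra_def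
    by (intro sum.cong refl) (simp add: algebra_simps add_divide_distrib)
  also have "\<dots> = fs_metric w \<xi>"
    by (simp add: fs_metric_def braket_def sum_distrib_left Re_sum)
  also have "\<dots> = fs_metric (hproj \<phi> w) \<xi>"
  proof -
    have "braket (v - c *s x) y = braket v y - cnj c * braket x y" for v x y :: "complex ^ 'a" and c
      by (simp add: braket_def algebra_simps sum_subtractf sum_distrib_left)
    then show ?thesis
      using \<xi> by (simp add: fs_metric_def hproj_def tangent_def)
  qed
  finally show ?thesis by (simp add: fs_grad_def w_def D_def)
qed

text \<open>\<open>M\<^sub>K\<close> is the Riemannian quotient of a product of spheres, so its Levi--Civita connection, in
  terms of horizontal lifts, is the horizontal projection of the ambient derivative. The Riemannian
  Hessian is \<open>Hess E[\<xi>, \<eta>] = g(\<nabla>\<^sub>\<xi> grad E, \<eta>)\<close>. As \<open>\<xi>\<close> is tangent to the spheres, only the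
  values of \<open>fs_grad E\<close> at unit tuples matter.\<close>

definition fs_hess ::
  "(('d::finite) cproj ^ ('k::finite) \<Rightarrow> real) \<Rightarrow> (complex ^ 'd) ^ 'k \<Rightarrow>
     (complex ^ 'd) ^ 'k \<Rightarrow> (complex ^ 'd) ^ 'k \<Rightarrow> real" where
  "fs_hess E \<phi> \<xi> \<eta> = fs_metric (hproj \<phi> (frechet_derivative (fs_grad E) (at \<phi>) \<xi>)) \<eta>"

text \<open>The greatest such \<open>l\<close> exists for \<open>C\<^sup>2\<close> functions when \<open>CARD('d) \<ge> 2\<close>, i.e. when the tangent
  spaces are nontrivial.\<close>

definition lambda_min ::
  "(('d::finite) cproj ^ ('k::finite) \<Rightarrow> real) \<Rightarrow> (complex ^ 'd) ^ 'k \<Rightarrow> real" where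
  "lambda_min E \<phi> =
     (GREATEST l. \<forall>\<xi>\<in>tangent \<phi>. fs_hess E \<phi> \<xi> \<xi> \<ge> l * fs_metric \<xi> \<xi>)"

definition nondegenerate_local_min ::
  "(('d::finite) cproj ^ ('k::finite) \<Rightarrow> real) \<Rightarrow> (complex ^ 'd) ^ 'k \<Rightarrow> bool" where
  "nondegenerate_local_min E \<phi> \<longleftrightarrow>
     (\<forall>\<^sub>F q in nhds (pt \<phi>). E (pt \<phi>) \<le> E q) \<and>
     (\<forall>\<xi>\<in>tangent \<phi>. (\<forall>\<eta>\<in>tangent \<phi>. fs_hess E \<phi> \<xi> \<eta> = 0) \<longrightarrow> \<xi> = 0)"


section \<open>Nonlinear imaginary-time evolution\<close>

text \<open>A curve \<open>c\<close> in \<open>M\<^sub>K\<close> defined for \<open>t \<ge> 0\<close> is a trajectory of the gradient flow iff it is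
  represented by unit vectors solving the evolution equation; the values of \<open>c\<close> at negative times
  are irrelevant.\<close>

definition NITE ::
  "(('d::finite) cproj ^ ('k::finite) \<Rightarrow> real) \<Rightarrow> (real \<Rightarrow> 'd cproj ^ 'k) \<Rightarrow> bool" where
  "NITE E c \<longleftrightarrow> (\<exists>\<phi> :: real \<Rightarrow> (complex ^ 'd) ^ 'k. \<forall>t\<ge>0.
     \<phi> t \<in> unit_tuples \<and> c t = pt (\<phi> t) \<and>
     (\<phi> has_vector_derivative - fs_grad E (\<phi> t)) (at t within {0..}))"

end

theory Submission
  imports Defs
begin

text \<open>
  Pull \<open>E\<close> back to \<open>f = E \<circ> pt\<close> on tuples of nonzero vectors. Since \<open>f\<close> is constant on rays, its
  Wirtinger derivative is already horizontal at every nonzero tuple; hence \<open>fs_grad E\<close> is half the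
  Euclidean gradient of \<open>f\<close>, and on tangent vectors the Riemannian Hessian is the second derivative
  of \<open>f\<close>. Near the minimum every point has a representative \<open>\<phi>s + \<xi>\<close> with \<open>\<xi>\<close> tangent at \<open>\<phi>s\<close>, and
  for \<open>\<mu> = 2 m < 2 \<lambda>\<^sub>*\<close> Taylor's theorem along \<open>\<xi>\<close> yields quadratic growth of \<open>f\<close> together with the
  Polyak--Lojasiewicz inequality \<open>m (f - f \<phi>s) \<le> |grad|\<^sup>2\<close>. Along the flow \<open>f\<close> has derivative
  \<open>- 2 |grad|\<^sup>2\<close>, so \<open>f - f \<phi>s\<close> decays at rate \<open>\<mu>\<close> as long as the trajectory stays in the region of
  validity; quadratic growth makes a sublevel set inside that region invariant.
\<close>

section \<open>Global solutions of ordinary differential equations\<close>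

text \<open>The weight \<open>exp (- (L + 1) t)\<close> makes the Picard operator a contraction on bounded continuous
  functions on the whole half-line.\<close>

lemma lipschitz_ode_global_solution:
  fixes F :: "'a::euclidean_space \<Rightarrow> 'a"
  assumes lip: "L-lipschitz_on UNIV F" and bnd: "\<And>x. norm (F x) \<le> B"
  obtains x where "x 0 = x0"
    and "\<And>t. t \<ge> 0 \<Longrightarrow> (x has_vector_derivative F (x t)) (at t within {0..})"
proof -
  have L0: "L \<ge> 0" using lip by (rule lipschitz_on_nonneg)
  have B0: "B \<ge> 0" by (rule order_trans[OF norm_ge_zero bnd])
  \<comment> \<open>Any rate above \<open>L\<close> gives a contraction constant
    \<open>L / a < 1\<close>; this one is also at least 1, which \<open>expt\<close> uses.\<close>
  define a where "a = L + 1"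
  have a1: "a \<ge> 1" using L0 by (simp add: a_def)
  have contF: "continuous_on UNIV F" using lip by (rule lipschitz_on_continuous_on)
  \<comment> \<open>The fixed point will be the weighted solution, so the weight is undone before
    \<open>F\<close> is applied.\<close>
  define g where "g y s = F (exp (a * s) *\<^sub>R apply_bcontfun y s)" for y :: "real \<Rightarrow>\<^sub>C 'a" and s
  have contg: "continuous_on S (g y)" for S y
    unfolding g_def
    by (intro continuous_on_compose2[OF contF] continuous_intros) auto
  define I where "I y t = integral {0..t} (g y)" for y t
  have dI: "(I y has_vector_derivative g y t) (at t within {0..})" if "t \<ge> 0" for y t
  proof -
    have "(I y has_vector_derivative g y t) (at t within {0..t+1})"
      unfolding I_def by (rule integral_has_vector_derivative) (use contg that in auto)
    moreover have "at t within {0..t+1} = at t within {0..}"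
      by (rule at_within_nhd[of _ "{..<t+1}"]) auto
    ultimately show ?thesis by simp
  qed
  have contI: "continuous_on {0..} (I y)" for y
    by (meson atLeast_iff continuous_on_eq_continuous_within dI has_vector_derivative_continuous)
  \<comment> \<open>Bounded continuous functions live on the whole line, so \<open>max t 0\<close>
    freezes negative times at the value at 0.\<close>
  define G where "G y t = exp (- a * max t 0) *\<^sub>R (x0 + I y (max t 0))" for y t
  \<comment> \<open>Absorbs the linear growth of \<open>I y\<close> when \<open>G y\<close> is shown
    to be bounded.\<close>
  have expt: "exp (- a * t) * t \<le> 1" if "t \<ge> 0" for t
  proof -
    have "t \<le> a * t" using a1 that by (simp add: mult_le_cancel_right1)
    also have "\<dots> \<le> exp (a * t)" using exp_ge_add_one_self[of "a * t"] by linarith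
    finally show ?thesis by (simp add: exp_minus field_simps)
  qed
  have GB: "G y \<in> bcontfun" for y
  proof (rule bcontfun_normI)
    show "continuous_on UNIV (G y)"
      unfolding G_def by (intro continuous_intros continuous_on_compose2[OF contI]) auto
    fix t :: real
    define s where "s = max t 0"
    have s: "s \<ge> 0" by (simp add: s_def)
    have "norm (I y s) \<le> B * (s - 0)"
      unfolding I_def by (rule integral_bound[OF s contg]) (simp add: g_def bnd)
    then have "norm (x0 + I y s) \<le> norm x0 + B * s"
      using norm_triangle_ineq[of x0 "I y s"] by simp
    then have "norm (G y t) \<le> exp (- a * s) * (norm x0 + B * s)"
      by (simp add: G_def flip: s_def)
    also have "\<dots> = exp (- a * s) * norm x0 + B * (exp (- a * s) * s)" by (simp add: algebra_simps)
    also have "\<dots> \<le> 1 * norm x0 + B * 1"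
      using s a1 B0 expt[OF s] by (intro add_mono mult_right_mono mult_left_mono) auto
    finally show "norm (G y t) \<le> norm x0 + B" by simp
  qed
  define T where "T y = Bcontfun (G y)" for y
  have T: "apply_bcontfun (T y) = G y" for y
    unfolding T_def by (rule Bcontfun_inverse[OF GB])
  have contr: "dist (T y) (T z) \<le> (L / a) * dist y z" for y z
  proof (rule dist_bound)
    fix t :: real
    define s where "s = max t 0"
    have s: "s \<ge> 0" by (simp add: s_def)
    define d where "d = dist y z"
    have d0: "d \<ge> 0" by (simp add: d_def)
    \<comment> \<open>Integrating the weighted Lipschitz bound divides by \<open>a\<close>; this is
      where the factor \<open>L / a\<close> arises.\<close>
    have hi: "((\<lambda>u. L * d * exp (a * u)) has_integral (L * d / a * exp (a * s) - L * d / a * exp (a * 0))) {0..s}"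
      using a1 by (intro fundamental_theorem_of_calculus s)
        (auto intro!: derivative_eq_intros simp flip: has_real_derivative_iff_has_vector_derivative)
    have bd: "norm (g y u - g z u) \<le> L * d * exp (a * u)" for u
    proof -
      have "norm (g y u - g z u) \<le> L * norm (exp (a * u) *\<^sub>R apply_bcontfun y u - exp (a * u) *\<^sub>R apply_bcontfun z u)"
        unfolding g_def by (rule lipschitz_on_normD[OF lip]) auto
      also have "\<dots> = L * (exp (a * u) * dist (apply_bcontfun y u) (apply_bcontfun z u))"
        by (simp add: dist_norm flip: scaleR_diff_right)
      also have "\<dots> \<le> L * (exp (a * u) * d)"
        unfolding d_def by (intro mult_left_mono dist_bounded L0) auto
      finally show ?thesis by (simp add: mult_ac)
    qed
    have "norm (I y s - I z s) = norm (integral {0..s} (\<lambda>u. g y u - g z u))"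
      unfolding I_def
      by (subst Henstock_Kurzweil_Integration.integral_diff)
         (auto intro: integrable_continuous_real contg)
    also have "\<dots> \<le> integral {0..s} (\<lambda>u. L * d * exp (a * u))"
      using bd hi
      by (intro Henstock_Kurzweil_Integration.integral_norm_bound_integral)
         (auto intro!: integrable_continuous_real continuous_intros contg)
    also have "\<dots> \<le> L * d / a * exp (a * s)"
      using integral_unique[OF hi] L0 d0 a1 by simp
    finally have "norm (I y s - I z s) \<le> L * d / a * exp (a * s)" .
    then have "exp (- a * s) * norm (I y s - I z s) \<le> exp (- a * s) * (L * d / a * exp (a * s))"
      by (intro mult_left_mono) auto
    also have "\<dots> = L / a * d" by (simp add: exp_minus)
    finally have "norm (exp (- a * s) *\<^sub>R (I y s - I z s)) \<le> L / a * d" by simp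
    then show "dist (apply_bcontfun (T y) t) (apply_bcontfun (T z) t) \<le> L / a * dist y z"
      by (simp add: T G_def dist_norm d_def s_def algebra_simps)
  qed
  have "\<exists>!y. T y = y"
    using L0 a1 contr by (intro banach_fix_type[of "L / a"]) (auto simp: a_def)
  then obtain y where y: "T y = y" by blast
  define x where "x t = x0 + I y t" for t
  have xt: "exp (a * t) *\<^sub>R apply_bcontfun y t = x t" if "t \<ge> 0" for t
  proof -
    have "apply_bcontfun y t = G y t" using T[of y] y by simp
    then show ?thesis using that by (simp add: G_def x_def exp_minus)
  qed
  show ?thesis
  proof
    show "x 0 = x0" by (simp add: x_def I_def)
    show "(x has_vector_derivative F (x t)) (at t within {0..})" if "t \<ge> 0" for t
      using dI[OF that, of y] xt[OF that]
      unfolding x_def g_def by (auto intro!: derivative_eq_intros)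
  qed
qed

text \<open>Makes \<open>F\<close> eligible for the global existence result without changing it on
  \<open>S\<close>. The cutoff is Lipschitz and vanishes outside a compact collar of
  \<open>S\<close> inside \<open>U\<close>, where \<open>F\<close> is itself bounded and
  Lipschitz.\<close>

lemma lipschitz_cutoff:
  fixes F :: "'a::{banach,heine_borel} \<Rightarrow> 'a"
  assumes "compact S" "S \<noteq> {}" "open U" "S \<subseteq> U"
    and F': "\<And>x. x \<in> U \<Longrightarrow> (F has_derivative blinfun_apply (F' x)) (at x)"
    and cont: "continuous_on U F'"
  obtains h L B where "\<And>x. x \<in> S \<Longrightarrow> h x = (1::real)" "\<And>x. x \<notin> U \<Longrightarrow> h x = 0"
    "L-lipschitz_on UNIV (\<lambda>x. h x *\<^sub>R F x)" "\<And>x. norm (h x *\<^sub>R F x) \<le> B"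
proof -
  obtain e where e: "e > 0" "{x. infdist x S \<le> e} \<subseteq> U"
    using compact_in_open_separated[OF assms(2,1,3,4)] by blast
  define C where "C = {x. infdist x S \<le> e}"
  have C: "compact C" "C \<subseteq> U"
    unfolding C_def using compact_infdist_le[OF assms(2,1) e(1)] e(2) by auto
  have ll: "local_lipschitz (UNIV::real set) U (\<lambda>_. F)"
    using F' cont
    by (intro c1_implies_local_lipschitz[where f' = "\<lambda>(t, x). F' x"] assms)
       (auto simp: case_prod_beta intro!: continuous_on_compose2[OF cont] continuous_intros)
  have contF: "continuous_on U F"
    by (meson F' continuous_at_imp_continuous_on has_derivative_continuous)
  have "local_lipschitz {0::real} C (\<lambda>_. F)"
    by (rule local_lipschitz_subset[OF ll]) (use C in auto)
  then obtain M where M: "M-lipschitz_on C F"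
    using local_lipschitz_compact_implies_lipschitz[of "{0::real}" C "\<lambda>_. F"] C contF
    by (auto intro: continuous_on_subset)
  obtain B where B: "\<And>x. x \<in> C \<Longrightarrow> norm (F x) \<le> B" "B > 0"
    using compact_imp_bounded[OF compact_continuous_image[OF continuous_on_subset[OF contF C(2)] C(1)]]
    by (auto simp: bounded_pos)
  \<comment> \<open>Falls linearly from 1 on \<open>S\<close> to 0 at distance \<open>e\<close>,
    hence has Lipschitz constant \<open>1 / e\<close>.\<close>
  define h where "h x = max 0 (1 - infdist x S / e)" for x
  have h01: "0 \<le> h x" "h x \<le> 1" for x
    using e(1) infdist_nonneg[of x S] by (auto simp: h_def)
  have hC: "h x = 0" if "x \<notin> C" for x
    using that e(1) by (auto simp: h_def C_def field_simps)
  have hlip: "\<bar>h x - h y\<bar> \<le> dist x y / e" for x y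
  proof -
    have "\<bar>h x - h y\<bar> \<le> \<bar>infdist x S / e - infdist y S / e\<bar>" by (auto simp: h_def)
    also have "\<dots> = \<bar>infdist x S - infdist y S\<bar> / e"
      using e(1) by (simp flip: diff_divide_distrib)
    also have "\<dots> \<le> dist x y / e"
      using e(1) by (intro divide_right_mono infdist_triangle_abs) auto
    finally show ?thesis .
  qed
  define L where "L = B / e + M"
  have M0: "M \<ge> 0" using M by (rule lipschitz_on_nonneg)
  have L0: "L \<ge> 0" using M0 B e by (simp add: L_def)
  \<comment> \<open>One point in \<open>C\<close> suffices: the roles of the points are symmetric,
    and if both lie outside, both values vanish.\<close>
  have in_C: "norm (h x *\<^sub>R F x - h y *\<^sub>R F y) \<le> L * dist x y" if x: "x \<in> C" for x y
  proof (cases "y \<in> C")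
    case True
    have "h x *\<^sub>R F x - h y *\<^sub>R F y = (h x - h y) *\<^sub>R F x + h y *\<^sub>R (F x - F y)"
      by (simp add: algebra_simps)
    also have "norm \<dots> \<le> \<bar>h x - h y\<bar> * norm (F x) + h y * norm (F x - F y)"
      using h01 by (intro norm_triangle_le) simp
    also have "\<dots> \<le> dist x y / e * B + 1 * (M * dist x y)"
      using hlip B(1)[OF x] h01 e lipschitz_onD[OF M x True]
      by (intro add_mono mult_mono) (auto simp: dist_norm)
    finally show ?thesis by (simp add: L_def algebra_simps)
  next
    case False
    then have "norm (h x *\<^sub>R F x - h y *\<^sub>R F y) = \<bar>h x - h y\<bar> * norm (F x)"
      using hC by simp
    also have "\<dots> \<le> dist x y / e * B"
      using hlip B(1)[OF x] e by (intro mult_mono) auto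
    also have "\<dots> \<le> L * dist x y"
      using M0 by (simp add: L_def algebra_simps)
    finally show ?thesis .
  qed
  show ?thesis
  proof
    show "h x = 1" if "x \<in> S" for x using that by (simp add: h_def)
    show "h x = 0" if "x \<notin> U" for x using that C hC by blast
    show "L-lipschitz_on UNIV (\<lambda>x. h x *\<^sub>R F x)"
    proof (rule lipschitz_onI)
      fix x y
      consider "x \<in> C" | "y \<in> C" | "x \<notin> C" "y \<notin> C" by blast
      then show "dist (h x *\<^sub>R F x) (h y *\<^sub>R F y) \<le> L * dist x y"
      proof cases
        case 1 then show ?thesis using in_C by (simp add: dist_norm)
      next
        case 2 then show ?thesis using in_C[of y x] by (simp add: dist_norm norm_minus_commute)
      next
        case 3 then show ?thesis using hC L0 by simp
      qed
    qed (rule L0)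
    show "norm (h x *\<^sub>R F x) \<le> B" for x
    proof (cases "x \<in> C")
      case True
      then show ?thesis using h01[of x] B(1)[OF True] mult_mono[of "h x" 1 "norm (F x)" B] by auto
    qed (use hC B in auto)
  qed
qed

section \<open>Quadratic lower bounds from the second derivative\<close>

text \<open>Both are second-order expansions with Lagrange remainder, based at 0 and at 1; the
  second is the first applied to \<open>u (1 - t)\<close>. The first serves quadratic growth, the
  second the gradient inequality.\<close>

lemma taylor_lower_bounds:
  fixes u u' u'' :: "real \<Rightarrow> real"
  assumes u': "\<And>t. 0 \<le> t \<Longrightarrow> t \<le> 1 \<Longrightarrow> (u has_real_derivative u' t) (at t)"
    and u'': "\<And>t. 0 \<le> t \<Longrightarrow> t \<le> 1 \<Longrightarrow> (u' has_real_derivative u'' t) (at t)"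
    and c: "\<And>t. 0 \<le> t \<Longrightarrow> t \<le> 1 \<Longrightarrow> 2 * c \<le> u'' t"
  shows "u 0 + u' 0 + c \<le> u 1" and "u 1 - u' 1 + c \<le> u 0"
proof -
  have main: "v 0 + v' 0 + c \<le> v 1"
    if "\<And>t. 0 \<le> t \<Longrightarrow> t \<le> 1 \<Longrightarrow> (v has_real_derivative v' t) (at t)"
      "\<And>t. 0 \<le> t \<Longrightarrow> t \<le> 1 \<Longrightarrow> (v' has_real_derivative v'' t) (at t)"
      "\<And>t. 0 \<le> t \<Longrightarrow> t \<le> 1 \<Longrightarrow> 2 * c \<le> v'' t" for v v' v'' :: "real \<Rightarrow> real"
  proof -
    \<comment> \<open>\<open>Maclaurin\<close> expects the derivatives as one sequence indexed by
      their order.\<close>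
    define D where "D m = (if m = 0 then v else if m = 1 then v' else v'')" for m :: nat
    have "\<exists>t. 0 < t \<and> t < 1 \<and> v 1 = (\<Sum>m<2. (D m 0 / fact m) * 1 ^ m) + (D 2 t / fact 2) * 1 ^ 2"
      using that by (intro Maclaurin) (auto simp: D_def less_2_cases_iff)
    then obtain t where "0 < t" "t < 1" "v 1 = v 0 + v' 0 + v'' t / 2"
      by (auto simp: D_def numeral_2_eq_2)
    then show ?thesis using that(3)[of t] by simp
  qed
  show "u 0 + u' 0 + c \<le> u 1" using main[OF u' u'' c] by simp
  have reflect: "((\<lambda>s. v (1 - s)) has_real_derivative - d) (at t)"
    if "(v has_real_derivative d) (at (1 - t))" for v :: "real \<Rightarrow> real" and d t
  proof -
    have "((\<lambda>s. 1 - s) has_real_derivative - 1) (at t)" by (auto intro!: derivative_eq_intros)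
    from DERIV_chain'[OF this that] show ?thesis by simp
  qed
  have "(\<lambda>t. u (1 - t)) 0 + (\<lambda>t. - u' (1 - t)) 0 + c \<le> (\<lambda>t. u (1 - t)) 1"
  proof (rule main[where v'' = "\<lambda>t. u'' (1 - t)"])
    fix t :: real assume t: "0 \<le> t" "t \<le> 1"
    show "((\<lambda>t. u (1 - t)) has_real_derivative - u' (1 - t)) (at t)"
      using t by (intro reflect u') auto
    show "((\<lambda>t. - u' (1 - t)) has_real_derivative u'' (1 - t)) (at t)"
      using DERIV_minus[OF reflect[OF u''[of "1 - t"]]] t by simp
    show "2 * c \<le> u'' (1 - t)" using t by (intro c) auto
  qed
  then show "u 1 - u' 1 + c \<le> u 0" by simp
qed

section \<open>Tuples of vectors and their rays\<close>

lemma inner_eq_Re_braket: "x \<bullet> y = Re (braket x y)"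
  by (simp add: inner_vec_def braket_def inner_complex_def)

lemma fs_metric_eq_inner: "fs_metric \<xi> \<eta> = 2 * (\<xi> \<bullet> \<eta>)"
  by (simp add: fs_metric_def inner_vec_def[of \<xi>] inner_eq_Re_braket sum_distrib_left)

lemma braket_scale_right: "braket x (c *s y) = c * braket x y"
  by (simp add: braket_def sum_distrib_left mult_ac)

lemma braket_scale_left: "braket (c *s x) y = cnj c * braket x y"
  by (simp add: braket_def sum_distrib_left mult_ac)

lemma braket_diff_right: "braket x (y - z) = braket x y - braket x z"
  by (simp add: braket_def algebra_simps sum_subtractf)

lemma braket_diff_left: "braket (y - z) x = braket y x - braket z x"
  by (simp add: braket_def algebra_simps sum_subtractf)

lemma braket_add_right: "braket x (y + z) = braket x y + braket x z"
  by (simp add: braket_def algebra_simps sum.distrib)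

lemma cnj_braket: "cnj (braket x y) = braket y x"
  by (simp add: braket_def mult_ac)

lemma braket_self: "braket x x = of_real ((norm x)\<^sup>2)"
proof -
  have "braket x x \<in> \<real>" by (metis cnj_braket Reals_cnj_iff)
  then have "braket x x = of_real (Re (braket x x))" by simp
  then show ?thesis by (simp add: power2_norm_eq_inner inner_eq_Re_braket)
qed

lemma braket_scaleR_right: "braket x (r *\<^sub>R y) = of_real r * braket x y"
  by (simp add: braket_def sum_distrib_left scaleR_conv_of_real[where 'a = complex] mult_ac)

lemma norm_vec_le_componentwise:
  fixes x :: "'a::real_normed_vector ^ 'n" and y :: "'b::real_normed_vector ^ 'n"
  assumes "\<And>i. norm (x $ i) \<le> norm (y $ i)"
  shows "norm x \<le> norm y"
  unfolding norm_vec_def by (intro L2_set_mono assms) simp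

text \<open>The componentwise action of scalars: for nonzero \<open>b\<close> it preserves rays, and
  for \<open>b\<close> of modulus 1 it changes only the phases of a representative.\<close>

definition rescale :: "('k \<Rightarrow> complex) \<Rightarrow> (complex ^ 'd) ^ 'k \<Rightarrow> (complex ^ 'd) ^ 'k" where
  "rescale b x = (\<chi> k. b k *s x $ k)"

lemma rescale_nth [simp]: "rescale b x $ k = b k *s x $ k"
  by (simp add: rescale_def)

lemma linear_rescale: "linear (rescale b)"
  by (rule linearI) (simp_all add: vec_eq_iff algebra_simps scaleR_conv_of_real[where 'a = complex])

lemma norm_rescale_le:
  assumes "\<And>k. norm (b k) \<le> 1"
  shows "norm (rescale b x) \<le> norm x"
  by (rule norm_vec_le_componentwise) (simp add: norm_vector_scalar_mult assms mult_left_le_one_le)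

lemma rescale_nonzero_tuples:
  "(\<And>k. b k \<noteq> 0) \<Longrightarrow> x \<in> nonzero_tuples \<Longrightarrow> rescale b x \<in> nonzero_tuples"
  by (simp add: nonzero_tuples_def)

lemma unit_tuples_nonzero: "unit_tuples \<subseteq> nonzero_tuples"
  by (auto simp: unit_tuples_def nonzero_tuples_def) (metis norm_zero zero_neq_one)

lemma open_nonzero_tuples: "open (nonzero_tuples :: ((complex ^ 'd) ^ 'k) set)"
  using open_vector_box[of "\<lambda>_::'k. - {0 :: complex ^ 'd}"] by (simp add: nonzero_tuples_def open_Compl)

lemma compact_unit_tuples: "compact (unit_tuples :: ((complex ^ 'd) ^ 'k) set)"
proof -
  have "closed (unit_tuples :: ((complex ^ 'd) ^ 'k) set)"
    unfolding unit_tuples_def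
    by (intro closed_Collect_all closed_Collect_eq continuous_intros)
  moreover have "norm x \<le> CARD('k)" if "x \<in> unit_tuples" for x :: "(complex ^ 'd) ^ 'k"
  proof -
    have "norm x \<le> (\<Sum>k\<in>UNIV. norm (x $ k))"
      unfolding norm_vec_def by (rule L2_set_le_sum) simp
    then show ?thesis using that by (simp add: unit_tuples_def)
  qed
  ultimately show ?thesis by (auto simp: compact_eq_bounded_closed bounded_iff)
qed

section \<open>Fibres and topology of the quotient map\<close>

lemma abs_cproj_eq_iff:
  assumes "norm x = 1" "norm y = 1"
  shows "abs_cproj x = abs_cproj y \<longleftrightarrow> (\<exists>c. norm c = 1 \<and> y = c *s x)"
proof -
  \<comment> \<open>The relation is only a partial equivalence, so equality of classes reduces to it
    where it is reflexive, at unit vectors.\<close>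
  have refl: "phase_equiv z z" if "norm z = 1" for z :: "complex ^ 'a"
    using that by (auto simp: phase_equiv_def intro!: exI[of _ 1])
  show ?thesis
    using Quotient_rel[OF Quotient_cproj, of x y] refl assms by (simp add: phase_equiv_def)
qed

lemma pt_unit_nth: "\<phi> \<in> unit_tuples \<Longrightarrow> pt \<phi> $ k = abs_cproj (\<phi> $ k)"
  by (simp add: pt_def unit_tuples_def)

text \<open>Normalizing removes the modulus of \<open>b k\<close>, so only its phase remains, and a
  phase does not change the class. A zero component is zero on both sides.\<close>

lemma pt_rescale:
  assumes "\<And>k. b k \<noteq> 0"
  shows "pt (rescale b x) = pt x"
proof -
  have "abs_cproj ((b k *s x $ k) /\<^sub>R norm (b k *s x $ k)) = abs_cproj (x $ k /\<^sub>R norm (x $ k))" for k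
  proof (cases "x $ k = 0")
    case False
    define c where "c = b k / of_real (norm (b k))"
    have "norm c = 1" using assms[of k] by (simp add: c_def norm_divide)
    moreover have "(b k *s x $ k) /\<^sub>R norm (b k *s x $ k) = c *s (x $ k /\<^sub>R norm (x $ k))"
      by (simp add: vec_eq_iff c_def norm_vector_scalar_mult scaleR_conv_of_real[where 'a = complex] divide_inverse mult_ac)
    moreover have "norm (x $ k /\<^sub>R norm (x $ k)) = 1" using False by simp
    ultimately show ?thesis
      by (metis abs_cproj_eq_iff mult_1 norm_vector_scalar_mult)
  qed simp
  then show ?thesis by (simp add: pt_def vec_eq_iff)
qed

lemma pt_eq_unit_tuplesE:
  assumes "pt \<phi> = pt \<psi>" "\<phi> \<in> unit_tuples" "\<psi> \<in> unit_tuples"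
  obtains b where "\<And>k. norm (b k) = 1" "\<psi> = rescale b \<phi>"
proof -
  have "\<exists>c. norm c = 1 \<and> \<psi> $ k = c *s \<phi> $ k" for k
  proof -
    have "abs_cproj (\<phi> $ k) = abs_cproj (\<psi> $ k)"
      using assms(1) by (simp flip: pt_unit_nth[OF assms(2)] pt_unit_nth[OF assms(3)])
    then show ?thesis using assms(2,3) by (subst (asm) abs_cproj_eq_iff) (auto simp: unit_tuples_def)
  qed
  then obtain b where "\<And>k. norm (b k) = 1 \<and> \<psi> $ k = b k *s \<phi> $ k" by metis
  then show ?thesis by (intro that[of b]) (auto simp: vec_eq_iff[of \<psi>])
qed

lemma continuous_on_abs_cproj: "continuous_on (sphere 0 1) abs_cproj"
proof -
  have "sphere 0 1 \<inter> abs_cproj -` U = {x \<in> sphere 0 1. abs_cproj x \<in> U}"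
    for U :: "'a cproj set" by auto
  then show ?thesis by (simp add: continuous_openin_preimage_eq open_cproj_def)
qed

lemma continuous_on_pt: "continuous_on nonzero_tuples pt"
  unfolding pt_def
  by (intro continuous_on_vec_lambda continuous_on_compose2[OF continuous_on_abs_cproj] continuous_intros)
    (auto simp: nonzero_tuples_def)

lemma continuous_on_vector_scalar_mult: "continuous_on S (\<lambda>x :: complex ^ 'n. c *s x)"
  unfolding vector_scalar_mult_def by (intro continuous_intros)

text \<open>The quotient map of a group action is open: the saturation of an open set is the union
  of its translates by unit scalars.\<close>

lemma open_abs_cproj_image:
  assumes "open A"
  shows "open (abs_cproj ` (A \<inter> sphere 0 1))"
proof -
  define U where "U = (\<Union>c\<in>{c. norm c = 1}. (\<lambda>x. c *s x) -` A)"
  have "open U"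
    unfolding U_def
    by (intro open_UN ballI open_vimage assms continuous_on_vector_scalar_mult)
  moreover have "{x \<in> sphere 0 1. abs_cproj x \<in> abs_cproj ` (A \<inter> sphere 0 1)} = sphere 0 1 \<inter> U"
  proof (intro equalityI subsetI)
    fix x assume "x \<in> {x \<in> sphere 0 1. abs_cproj x \<in> abs_cproj ` (A \<inter> sphere 0 1)}"
    then obtain y where "norm x = 1" "norm y = 1" "y \<in> A" "abs_cproj x = abs_cproj y"
      by auto
    then show "x \<in> sphere 0 1 \<inter> U"
      by (auto simp: U_def abs_cproj_eq_iff)
  next
    fix x assume "x \<in> sphere 0 1 \<inter> U"
    then obtain c where c: "norm x = 1" "norm c = 1" "c *s x \<in> A" by (auto simp: U_def)
    then have "abs_cproj x = abs_cproj (c *s x)"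
      by (subst abs_cproj_eq_iff) (auto simp: norm_vector_scalar_mult)
    moreover have "c *s x \<in> A \<inter> sphere 0 1" using c by (simp add: norm_vector_scalar_mult)
    ultimately have "abs_cproj x \<in> abs_cproj ` (A \<inter> sphere 0 1)" by (rule image_eqI)
    then show "x \<in> {x \<in> sphere 0 1. abs_cproj x \<in> abs_cproj ` (A \<inter> sphere 0 1)}"
      using c(1) by simp
  qed
  ultimately show ?thesis unfolding open_cproj_def by (simp add: openin_open_Int)
qed

text \<open>Turns a neighbourhood of a representative into one in the manifold. In the product
  topology it suffices to apply \<open>open_abs_cproj_image\<close> to each factor of a box inside
  \<open>W\<close>.\<close>

lemma open_pt_image:
  assumes "open W"
  shows "open (pt ` (W \<inter> unit_tuples))"
  unfolding open_vec_def
proof safe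
  fix \<phi> :: "(complex ^ 'a) ^ 'b" assume \<phi>: "\<phi> \<in> W" "\<phi> \<in> unit_tuples"
  obtain A where A: "\<And>i. open (A i)" "\<And>i. \<phi> $ i \<in> A i" "\<And>y. (\<forall>i. y $ i \<in> A i) \<Longrightarrow> y \<in> W"
    using assms \<phi>(1) unfolding open_vec_def by metis
  show "\<exists>B. (\<forall>i. open (B i) \<and> pt \<phi> $ i \<in> B i) \<and> (\<forall>y. (\<forall>i. y $ i \<in> B i) \<longrightarrow> y \<in> pt ` (W \<inter> unit_tuples))"
  proof (intro exI[of _ "\<lambda>i. abs_cproj ` (A i \<inter> sphere 0 1)"] conjI allI impI)
    show "open (abs_cproj ` (A i \<inter> sphere 0 1))" for i
      by (intro open_abs_cproj_image A)
    show "pt \<phi> $ i \<in> abs_cproj ` (A i \<inter> sphere 0 1)" for i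
      using A(2)[of i] \<phi>(2) by (simp add: pt_unit_nth[OF \<phi>(2)]) (simp add: unit_tuples_def)
    fix y :: "'a cproj ^ 'b" assume "\<forall>i. y $ i \<in> abs_cproj ` (A i \<inter> sphere 0 1)"
    then have "\<exists>z. z \<in> A i \<and> norm z = 1 \<and> y $ i = abs_cproj z" for i
      by (rule allE[of _ i], elim imageE) auto
    then obtain z where z: "\<And>i. z i \<in> A i \<and> norm (z i) = 1 \<and> y $ i = abs_cproj (z i)" by metis
    define \<psi> where "\<psi> = (\<chi> i. z i)"
    have \<psi>: "\<psi> \<in> unit_tuples" using z by (simp add: \<psi>_def unit_tuples_def)
    have "\<psi> \<in> W" by (rule A(3)) (simp add: \<psi>_def z)
    moreover have "y $ i = pt \<psi> $ i" for i
      using z[of i] unfolding pt_unit_nth[OF \<psi>] by (simp add: \<psi>_def)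
    then have "y = pt \<psi>" by (simp add: vec_eq_iff)
    ultimately show "y \<in> pt ` (W \<inter> unit_tuples)" using \<psi> by blast
  qed
qed

section \<open>Horizontal projection and an affine chart\<close>

lemma linear_hproj: "linear (hproj \<phi>)"
proof (rule linearI)
  show "hproj \<phi> (x + y) = hproj \<phi> x + hproj \<phi> y" for x y
    by (simp add: hproj_def vec_eq_iff braket_add_right algebra_simps)
  show "hproj \<phi> (r *\<^sub>R x) = r *\<^sub>R hproj \<phi> x" for r x
    by (simp add: hproj_def vec_eq_iff braket_scaleR_right scaleR_conv_of_real[where 'a = complex] algebra_simps)
qed

text \<open>The part removed from \<open>v $ k\<close> is a complex multiple of
  \<open>\<phi> $ k\<close>, to which \<open>\<eta> $ k\<close> is orthogonal.\<close>

lemma inner_hproj_tangent: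
  assumes "\<eta> \<in> tangent \<phi>"
  shows "hproj \<phi> v \<bullet> \<eta> = v \<bullet> \<eta>"
  using assms
  by (simp add: inner_vec_def[of _ \<eta>] inner_eq_Re_braket hproj_def tangent_def braket_diff_left braket_scale_left)

lemma hproj_rescale: "hproj \<phi> (rescale b v) = rescale b (hproj \<phi> v)"
  by (simp add: hproj_def vec_eq_iff braket_scale_right algebra_simps)

lemma norm_rescale_unit:
  assumes "\<And>k. norm (b k) = 1"
  shows "norm (rescale b x) = norm x"
  by (simp add: norm_vec_def[of x] norm_vec_def[of "rescale b x"] norm_vector_scalar_mult assms)

text \<open>By Pythagoras. It keeps the segments used in Taylor's theorem away from zero
  components.\<close>

lemma norm_add_tangent_ge:
  assumes "\<phi> \<in> unit_tuples" "\<xi> \<in> tangent \<phi>"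
  shows "1 \<le> norm ((\<phi> + \<xi>) $ k)"
proof -
  have "\<phi> $ k \<bullet> \<xi> $ k = 0" using assms by (simp add: inner_eq_Re_braket tangent_def)
  then have "(norm ((\<phi> + \<xi>) $ k))\<^sup>2 = (norm (\<phi> $ k))\<^sup>2 + (norm (\<xi> $ k))\<^sup>2"
    by (simp add: power2_norm_eq_inner inner_add inner_commute)
  then have "1\<^sup>2 \<le> (norm ((\<phi> + \<xi>) $ k))\<^sup>2" using assms by (simp add: unit_tuples_def)
  then show ?thesis by (rule power2_le_imp_le) simp
qed

text \<open>The chart is \<open>\<phi>\<^sub>k = \<langle>\<phi>\<^sub>0\<^sub>k|\<phi>\<^sub>k\<rangle> (\<phi>\<^sub>0\<^sub>k + \<xi>\<^sub>k)\<close> with \<open>\<xi>\<^sub>k\<close> orthogonal to \<open>\<phi>\<^sub>0\<^sub>k\<close>.\<close>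

lemma affine_chart:
  assumes "\<phi>0 \<in> unit_tuples" "\<phi> \<in> unit_tuples" and small: "norm (hproj \<phi>0 \<phi>) \<le> 1 / 2"
  obtains b \<xi> where "\<And>k. b k \<noteq> 0" "\<And>k. norm (b k) \<le> 1" "\<xi> \<in> tangent \<phi>0"
    "\<phi> = rescale b (\<phi>0 + \<xi>)" "norm (hproj \<phi>0 \<phi>) \<le> norm \<xi>" "norm \<xi> \<le> 2 * norm (hproj \<phi>0 \<phi>)"
proof -
  define h where "h = hproj \<phi>0 \<phi>"
  define b where "b k = braket (\<phi>0 $ k) (\<phi> $ k)" for k
  have unit: "norm (\<phi>0 $ k) = 1" "norm (\<phi> $ k) = 1" for k
    using assms by (auto simp: unit_tuples_def)
  have hk: "h $ k = \<phi> $ k - b k *s \<phi>0 $ k" for k by (simp add: h_def hproj_def b_def)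
  have orth: "braket (\<phi>0 $ k) (h $ k) = 0" for k
    by (simp add: hk braket_diff_right braket_scale_right b_def braket_self unit)
  have b2: "(norm (b k))\<^sup>2 = 1 - (norm (h $ k))\<^sup>2" for k
  proof -
    have "\<phi> $ k = b k *s \<phi>0 $ k + h $ k" by (simp add: hk)
    moreover have "(b k *s \<phi>0 $ k) \<bullet> (h $ k) = 0"
      by (simp add: inner_eq_Re_braket braket_scale_left orth)
    ultimately have "(norm (\<phi> $ k))\<^sup>2 = (norm (b k *s \<phi>0 $ k))\<^sup>2 + (norm (h $ k))\<^sup>2"
      by (simp add: power2_norm_eq_inner inner_add inner_commute)
    then show ?thesis by (simp add: unit norm_vector_scalar_mult)
  qed
  have b_le: "norm (b k) \<le> 1" for k
    by (rule power2_le_imp_le) (use b2[of k] in auto)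
  \<comment> \<open>Smallness of \<open>h\<close> keeps the overlap \<open>b k\<close> away from 0,
    so that dividing by it at most doubles norms.\<close>
  have b_ge: "1 / 2 \<le> norm (b k)" for k
  proof (rule power2_le_imp_le)
    have "norm (h $ k) \<le> 1 / 2"
      using small Finite_Cartesian_Product.norm_nth_le[of h k] by (simp add: h_def)
    then have "(norm (h $ k))\<^sup>2 \<le> (1 / 2)\<^sup>2" by (intro power_mono) auto
    then show "(1 / 2)\<^sup>2 \<le> (norm (b k))\<^sup>2" unfolding b2 by (simp add: power2_eq_square)
  qed simp
  have b0: "b k \<noteq> 0" for k using b_ge[of k] by auto
  define \<xi> where "\<xi> = rescale (\<lambda>k. inverse (b k)) h"
  have n\<xi>: "norm (\<xi> $ k) = norm (h $ k) / norm (b k)" for k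
    by (simp add: \<xi>_def norm_vector_scalar_mult norm_inverse divide_inverse_commute)
  show ?thesis
  proof
    show "b k \<noteq> 0" "norm (b k) \<le> 1" for k by (fact b0 b_le)+
    show "\<xi> \<in> tangent \<phi>0" by (simp add: \<xi>_def tangent_def braket_scale_right orth)
    show "\<phi> = rescale b (\<phi>0 + \<xi>)"
      by (simp add: vec_eq_iff[where 'b = 'b] \<xi>_def hk vector_add_ldistrib b0)
    show "norm (hproj \<phi>0 \<phi>) \<le> norm \<xi>"
      unfolding h_def[symmetric]
    proof (rule norm_vec_le_componentwise)
      show "norm (h $ k) \<le> norm (\<xi> $ k)" for k
        using b_le[of k] b0[of k] by (simp add: n\<xi> pos_le_divide_eq mult_left_le)
    qed
    have "norm \<xi> \<le> norm (2 *\<^sub>R h)"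
    proof (rule norm_vec_le_componentwise)
      fix k
      have "norm (h $ k) \<le> 2 * norm (h $ k) * norm (b k)"
        using mult_left_mono[OF b_ge[of k], of "2 * norm (h $ k)"] by simp
      then show "norm (\<xi> $ k) \<le> norm ((2 *\<^sub>R h) $ k)"
        using b0[of k] by (simp add: n\<xi> pos_divide_le_eq)
    qed
    then show "norm \<xi> \<le> 2 * norm (hproj \<phi>0 \<phi>)" by (simp add: h_def)
  qed
qed

section \<open>Gradient vectors and the Wirtinger derivative\<close>

definition riesz :: "('a::euclidean_space \<Rightarrow>\<^sub>L real) \<Rightarrow> 'a" where
  "riesz D = (\<Sum>b\<in>Basis. blinfun_apply D b *\<^sub>R b)"

lemma inner_riesz: "riesz D \<bullet> v = blinfun_apply D v"
proof -
  have "blinfun_apply D v = blinfun_apply D (\<Sum>b\<in>Basis. (v \<bullet> b) *\<^sub>R b)"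
    by (simp add: euclidean_representation)
  then show ?thesis
    by (simp add: riesz_def inner_sum_left blinfun.sum_right blinfun.scaleR_right mult_ac inner_commute[of v])
qed

lemma bounded_linear_riesz: "bounded_linear riesz"
  unfolding riesz_def
  by (intro bounded_linear_sum bounded_linear_compose[OF bounded_linear_scaleR_left]
      blinfun.bounded_linear_left)

text \<open>The factor 2 undoes the division by 2 in the Wirtinger derivative, which is therefore
  half the Euclidean gradient. It suffices to compare on the real basis of vectors with a single
  entry 1 or i.\<close>

lemma inner_wirtinger_bra:
  assumes "(f has_derivative blinfun_apply D) (at x)"
  shows "2 * (wirtinger_bra f x \<bullet> v) = blinfun_apply D v"
proof -
  have fd: "frechet_derivative f (at x) = blinfun_apply D"
    by (rule frechet_derivative_at[OF assms, symmetric])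
  have "(2 *\<^sub>R wirtinger_bra f x) \<bullet> v = riesz D \<bullet> v" for v
  proof (rule arg_cong[of _ _ "\<lambda>w. w \<bullet> v"], rule euclidean_eqI)
    fix e :: "(complex ^ 'a) ^ 'b" assume "e \<in> Basis"
    then obtain k j u where e: "e = axis k (axis j u)" and "u = 1 \<or> u = \<i>"
      by (auto simp: Basis_vec_def Basis_complex_def)
    then show "(2 *\<^sub>R wirtinger_bra f x) \<bullet> e = riesz D \<bullet> e"
      unfolding inner_riesz by (auto simp: inner_axis wirtinger_bra_def fd inner_complex_def)
  qed
  then show ?thesis by (simp add: inner_riesz)
qed

section \<open>The pulled-back energy\<close>

locale C2_energy =
  fixes E :: "('d::finite) cproj ^ ('k::finite) \<Rightarrow> real"
    and f' :: "(complex ^ 'd) ^ 'k \<Rightarrow> ((complex ^ 'd) ^ 'k) \<Rightarrow>\<^sub>L real"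
    and f'' :: "(complex ^ 'd) ^ 'k \<Rightarrow> ((complex ^ 'd) ^ 'k) \<Rightarrow>\<^sub>L (((complex ^ 'd) ^ 'k) \<Rightarrow>\<^sub>L real)"
  assumes has_derivative_pullback:
      "x \<in> nonzero_tuples \<Longrightarrow> (E \<circ> pt has_derivative blinfun_apply (f' x)) (at x)"
    and has_derivative_f':
      "x \<in> nonzero_tuples \<Longrightarrow> (f' has_derivative blinfun_apply (f'' x)) (at x)"
    and continuous_f'': "continuous_on nonzero_tuples f''"
begin

abbreviation "f \<equiv> E \<circ> pt"

section \<open>Invariance under rescaling and horizontality of the gradient\<close>

lemma pullback_rescale: "(\<And>k. b k \<noteq> 0) \<Longrightarrow> f (rescale b x) = f x"
  by (simp add: pt_rescale)

text \<open>The chain rule applied to \<open>f (rescale b x) = f x\<close>, the map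
  \<open>rescale b\<close> being linear.\<close>

lemma f'_rescale:
  assumes "x \<in> nonzero_tuples" "\<And>k. b k \<noteq> 0"
  shows "blinfun_apply (f' x) v = blinfun_apply (f' (rescale b x)) (rescale b v)"
proof -
  have "(rescale b has_derivative rescale b) (at x)"
    by (intro bounded_linear_imp_has_derivative) (simp add: linear_rescale linear_linear)
  from diff_chain_at[OF this has_derivative_pullback[OF rescale_nonzero_tuples[OF assms(2,1)]]]
  have "(f has_derivative blinfun_apply (f' (rescale b x)) \<circ> rescale b) (at x)"
    using pullback_rescale[OF assms(2)] by (simp add: comp_def)
  from has_derivative_unique[OF has_derivative_pullback[OF assms(1)] this]
  show ?thesis by (simp add: fun_eq_iff)
qed

text \<open>Multiplying the \<open>k\<close>-th component by \<open>1 + t * c\<close> leaves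
  \<open>f\<close> unchanged while this factor is nonzero, in particular for \<open>t\<close> near
  0, so the derivative along this curve vanishes.\<close>

lemma f'_vertical:
  assumes "x \<in> nonzero_tuples"
  shows "blinfun_apply (f' x) (axis k (c *s x $ k)) = 0"
proof -
  define v where "v = axis k (c *s x $ k)"
  define p where "p t = x + t *\<^sub>R v" for t :: real
  have dp: "(p has_derivative (\<lambda>t. t *\<^sub>R v)) (at 0)"
    unfolding p_def by (auto intro!: derivative_eq_intros)
  have "(f has_derivative blinfun_apply (f' x)) (at (p 0))"
    using has_derivative_pullback[OF assms] by (simp add: p_def)
  from diff_chain_at[OF dp this]
  have d1: "(f \<circ> p has_derivative (\<lambda>t. blinfun_apply (f' x) (t *\<^sub>R v))) (at 0)"
    by (simp add: comp_def)
  have "((\<lambda>t. 1 + of_real t * c) \<longlongrightarrow> 1 + of_real 0 * c) (at (0::real))"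
    by (intro tendsto_intros)
  then have "\<forall>\<^sub>F t::real in at 0. 1 + of_real t * c \<noteq> 0"
    by (rule tendsto_imp_eventually_ne) simp
  moreover have "(f \<circ> p) t = f x" if "1 + of_real t * c \<noteq> 0" for t
  proof -
    define b where "b j = (if j = k then 1 + of_real t * c else 1)" for j
    have "p t = rescale b x"
      by (auto simp: vec_eq_iff p_def v_def b_def axis_def algebra_simps
          scaleR_conv_of_real[where 'a = complex])
    then show ?thesis using pullback_rescale[of b x] that by (simp add: b_def)
  qed
  ultimately have "\<forall>\<^sub>F t in at 0. f x = (f \<circ> p) t"
    by (auto elim: eventually_mono)
  moreover have "((\<lambda>_. f x) has_derivative (\<lambda>_. 0)) (at (0::real))" by simp
  ultimately have "(f \<circ> p has_derivative (\<lambda>_. 0)) (at 0)"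
    by (elim has_derivative_transform_eventually[rotated]) (simp_all add: p_def)
  from fun_cong[OF has_derivative_unique[OF d1 this], of 1] show ?thesis
    by (simp add: v_def)
qed

text \<open>The derivative is tested on the vertical direction \<open>c *s x $ k\<close> with
  \<open>c\<close> the braket itself; the value is the squared modulus of \<open>c\<close>.\<close>

lemma wirtinger_bra_orthogonal:
  assumes "x \<in> nonzero_tuples"
  shows "braket (x $ k) (wirtinger_bra f x $ k) = 0"
proof -
  define w where "w = wirtinger_bra f x $ k"
  define c where "c = braket (x $ k) w"
  have "0 = wirtinger_bra f x \<bullet> axis k (c *s x $ k)"
    using inner_wirtinger_bra[OF has_derivative_pullback[OF assms], of "axis k (c *s x $ k)"]
      f'_vertical[OF assms, of k c] by simp
  also have "\<dots> = Re (c * cnj c)"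
    by (simp add: inner_axis inner_eq_Re_braket braket_scale_right c_def cnj_braket flip: w_def)
  finally have "c = 0" by (simp add: complex_mult_cnj flip: cmod_power2)
  then show ?thesis by (simp add: c_def w_def)
qed

lemma fs_grad_eq_wirtinger_bra:
  "x \<in> nonzero_tuples \<Longrightarrow> fs_grad E x = wirtinger_bra f x"
  by (simp add: fs_grad_def hproj_def vec_eq_iff wirtinger_bra_orthogonal)

lemma fs_grad_orthogonal: "x \<in> nonzero_tuples \<Longrightarrow> braket (x $ k) (fs_grad E x $ k) = 0"
  by (simp add: fs_grad_eq_wirtinger_bra wirtinger_bra_orthogonal)

section \<open>Gradient, Hessian and its smallest eigenvalue\<close>

lemma f'_eq_fs_grad: "x \<in> nonzero_tuples \<Longrightarrow> blinfun_apply (f' x) v = 2 * (fs_grad E x \<bullet> v)"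
  by (simp add: fs_grad_eq_wirtinger_bra inner_wirtinger_bra[OF has_derivative_pullback])

lemma fs_grad_eq_riesz: "x \<in> nonzero_tuples \<Longrightarrow> fs_grad E x = (1 / 2) *\<^sub>R riesz (f' x)"
  by (rule euclidean_eqI) (simp add: inner_riesz f'_eq_fs_grad)

text \<open>Packaged as a bounded linear operator so that its continuity in \<open>x\<close> can be
  stated and passed to \<open>lipschitz_cutoff\<close>.\<close>

definition fs_grad_derivative :: "(complex ^ 'd) ^ 'k \<Rightarrow> ((complex ^ 'd) ^ 'k) \<Rightarrow>\<^sub>L ((complex ^ 'd) ^ 'k)" where
  "fs_grad_derivative x = Blinfun (\<lambda>D. (1 / 2) *\<^sub>R riesz D) o\<^sub>L f'' x"

lemma fs_grad_derivative_apply: "blinfun_apply (fs_grad_derivative x) v = (1 / 2) *\<^sub>R riesz (blinfun_apply (f'' x) v)"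
  unfolding fs_grad_derivative_def blinfun_apply_blinfun_compose
  by (subst bounded_linear_Blinfun_apply)
    (intro bounded_linear_compose[OF bounded_linear_scaleR_right bounded_linear_riesz] refl)+

lemma continuous_fs_grad_derivative: "continuous_on nonzero_tuples fs_grad_derivative"
  unfolding fs_grad_derivative_def by (intro continuous_intros continuous_f'')

lemma has_derivative_fs_grad:
  assumes "x \<in> nonzero_tuples"
  shows "(fs_grad E has_derivative blinfun_apply (fs_grad_derivative x)) (at x)"
proof -
  have "((\<lambda>x. (1 / 2) *\<^sub>R riesz (f' x)) has_derivative
      (\<lambda>v. (1 / 2) *\<^sub>R riesz (blinfun_apply (f'' x) v))) (at x)"
    by (intro has_derivative_scaleR_right bounded_linear.has_derivative[OF bounded_linear_riesz]
        has_derivative_f' assms)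
  then have "((\<lambda>x. (1 / 2) *\<^sub>R riesz (f' x)) has_derivative blinfun_apply (fs_grad_derivative x)) (at x)"
    by (simp add: fs_grad_derivative_apply[abs_def])
  then show ?thesis
    by (rule has_derivative_transform_within_open[OF _ open_nonzero_tuples assms])
      (simp add: fs_grad_eq_riesz)
qed

text \<open>The projection drops out against a tangent vector, and the factor 2 of the metric
  cancels the half in \<open>fs_grad_derivative\<close>.\<close>

lemma fs_hess_eq:
  assumes "\<phi> \<in> nonzero_tuples" "\<eta> \<in> tangent \<phi>"
  shows "fs_hess E \<phi> \<xi> \<eta> = blinfun_apply (blinfun_apply (f'' \<phi>) \<xi>) \<eta>"
  by (simp add: fs_hess_def fs_metric_eq_inner inner_hproj_tangent[OF assms(2)] fs_grad_derivative_apply inner_riesz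
      flip: frechet_derivative_at[OF has_derivative_fs_grad[OF assms(1)]])

text \<open>\<open>GREATEST\<close> is informative only once a maximum is known to exist. The
  admissible values include \<open>- norm (f'' \<phi>)\<close>, are bounded above because a nonzero
  tangent vector exists, and contain their supremum because each inequality is closed in
  \<open>l\<close>.\<close>

lemma lambda_min_le:
  assumes "CARD('d) \<ge> 2" "\<phi> \<in> nonzero_tuples" "\<xi> \<in> tangent \<phi>"
  shows "lambda_min E \<phi> * (2 * (norm \<xi>)\<^sup>2) \<le> blinfun_apply (blinfun_apply (f'' \<phi>) \<xi>) \<xi>"
proof -
  define H where "H \<xi> = blinfun_apply (blinfun_apply (f'' \<phi>) \<xi>) \<xi>" for \<xi>
  define P where "P l \<longleftrightarrow> (\<forall>\<xi>\<in>tangent \<phi>. l * (2 * (norm \<xi>)\<^sup>2) \<le> H \<xi>)" for l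
  have P: "(\<lambda>l. \<forall>\<xi>\<in>tangent \<phi>. l * fs_metric \<xi> \<xi> \<le> fs_hess E \<phi> \<xi> \<xi>) = P"
    by (simp add: fun_eq_iff P_def H_def fs_hess_eq[OF assms(2)] fs_metric_eq_inner power2_norm_eq_inner)
  have lower: "P (- norm (f'' \<phi>))"
    unfolding P_def
  proof
    fix \<xi> assume "\<xi> \<in> tangent \<phi>"
    have "\<bar>H \<xi>\<bar> \<le> norm (blinfun_apply (f'' \<phi>) \<xi>) * norm \<xi>"
      unfolding H_def real_norm_def[symmetric] by (rule norm_blinfun)
    also have "\<dots> \<le> norm (f'' \<phi>) * norm \<xi> * norm \<xi>"
      by (intro mult_right_mono norm_blinfun) auto
    finally have "\<bar>H \<xi>\<bar> \<le> norm (f'' \<phi>) * (norm \<xi>)\<^sup>2" by (simp add: power2_eq_square)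
    moreover have "0 \<le> norm (f'' \<phi>) * (norm \<xi>)\<^sup>2" by simp
    ultimately show "- norm (f'' \<phi>) * (2 * (norm \<xi>)\<^sup>2) \<le> H \<xi>" by linarith
  qed
  obtain \<xi>0 where \<xi>0: "\<xi>0 \<in> tangent \<phi>" "\<xi>0 \<noteq> 0"
  proof -
    have "\<not> (\<forall>i\<in>UNIV :: 'd set. \<forall>j\<in>UNIV. i = j)"
      using assms(1) by (subst card_le_Suc0_iff_eq[symmetric]) auto
    then obtain i j :: 'd where ij: "i \<noteq> j" by blast
    fix k :: 'k
    define y where "y = \<phi> $ k"
    obtain x where x: "x \<noteq> 0" "braket y x = 0"
    proof (cases "y $ i = 0")
      case True
      then show ?thesis
        by (intro that[of "axis i 1"]) (simp_all add: braket_def axis_def vec_eq_iff if_distrib cong: if_cong)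
    next
      case False
      \<comment> \<open>Swapped conjugate entries with opposite signs make the two terms of the
        braket cancel.\<close>
      define x where "x = axis i (cnj (y $ j)) - axis j (cnj (y $ i))"
      have "x $ j = - cnj (y $ i)" using ij by (simp add: x_def axis_def)
      then have "x \<noteq> 0" using False by auto
      moreover have "braket y x = 0"
        by (simp add: x_def braket_diff_right) (simp add: braket_def axis_def if_distrib mult_ac cong: if_cong)
      ultimately show ?thesis by (rule that)
    qed
    show ?thesis
    proof (rule that[of "axis k x"])
      show "axis k x \<in> tangent \<phi>"
        using x by (auto simp: tangent_def axis_def y_def braket_def)
      show "axis k x \<noteq> 0" using x(1) by simp
    qed
  qed
  have upper: "l \<le> H \<xi> / (2 * (norm \<xi>)\<^sup>2)" if "P l" "\<xi> \<in> tangent \<phi>" "\<xi> \<noteq> 0" for l \<xi>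
    using that by (simp add: P_def pos_le_divide_eq)
  have bdd: "bdd_above {l. P l}" by (rule bdd_aboveI) (use upper[OF _ \<xi>0] in auto)
  define S where "S = Sup {l. P l}"
  have "P S"
    unfolding P_def
  proof
    fix \<xi> assume \<xi>: "\<xi> \<in> tangent \<phi>"
    show "S * (2 * (norm \<xi>)\<^sup>2) \<le> H \<xi>"
    proof (cases "\<xi> = 0")
      case False
      have "S \<le> H \<xi> / (2 * (norm \<xi>)\<^sup>2)"
        unfolding S_def by (rule cSup_least) (use lower upper \<xi> False in auto)
      then show ?thesis using False by (simp add: pos_le_divide_eq)
    qed (simp add: H_def blinfun.zero_right)
  qed
  moreover have "l \<le> S" if "P l" for l
    unfolding S_def using bdd that by (intro cSup_upper) auto
  ultimately have "P (Greatest P)" by (rule GreatestI2_order)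
  then show ?thesis using assms(3) unfolding lambda_min_def P by (simp add: P_def H_def)
qed

text \<open>Continuity of \<open>pt\<close> pulls the minimum back to an interior local minimum of
  \<open>f\<close> in the ambient space.\<close>

lemma pullback_critical:
  assumes "\<phi> \<in> nonzero_tuples" "\<forall>\<^sub>F q in nhds (pt \<phi>). E (pt \<phi>) \<le> E q"
  shows "f' \<phi> = 0"
proof -
  have "isCont pt \<phi>"
    using continuous_on_pt assms(1) continuous_on_eq_continuous_at[OF open_nonzero_tuples] by blast
  then have "(pt \<longlongrightarrow> pt \<phi>) (nhds \<phi>)" by (simp add: tendsto_at_iff_tendsto_nhds isCont_def)
  then have "\<forall>\<^sub>F x in nhds \<phi>. f \<phi> \<le> f x"
    using eventually_compose_filterlim[OF assms(2)] by simp
  then obtain S where "open S" "\<phi> \<in> S" "\<And>x. x \<in> S \<Longrightarrow> f \<phi> \<le> f x"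
    unfolding eventually_nhds by blast
  then obtain e where "e > 0" "\<forall>x\<in>ball \<phi> e. f \<phi> \<le> f x"
    by (metis open_contains_ball subsetD)
  then have "blinfun_apply (f' \<phi>) = (\<lambda>_. 0)"
    by (intro differential_zero_maxmin[OF _ _ has_derivative_pullback[OF assms(1)], of "ball \<phi> e"]) auto
  then show ?thesis by (simp add: blinfun_eqI)
qed

text \<open>The cut-off field has a global solution. The field is orthogonal to each component of
  the point, so component norms are preserved; the solution stays among unit tuples, where the
  cutoff equals 1.\<close>

lemma NITE_exists:
  assumes "\<phi>0 \<in> unit_tuples"
  obtains c where "NITE E c" "c 0 = pt \<phi>0"
proof -
  obtain h L B where h: "\<And>x. x \<in> unit_tuples \<Longrightarrow> h x = (1::real)" "\<And>x. x \<notin> nonzero_tuples \<Longrightarrow> h x = 0"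
    "L-lipschitz_on UNIV (\<lambda>x. h x *\<^sub>R fs_grad E x)" "\<And>x. norm (h x *\<^sub>R fs_grad E x) \<le> B"
    using lipschitz_cutoff[OF compact_unit_tuples _ open_nonzero_tuples unit_tuples_nonzero
        has_derivative_fs_grad continuous_fs_grad_derivative] assms by blast
  have "L-lipschitz_on UNIV (\<lambda>x. - (h x *\<^sub>R fs_grad E x))" using h(3) by simp
  then obtain x where x: "x 0 = \<phi>0"
    "\<And>t. t \<ge> 0 \<Longrightarrow> (x has_vector_derivative - (h (x t) *\<^sub>R fs_grad E (x t))) (at t within {0..})"
    using lipschitz_ode_global_solution[of L "\<lambda>x. - (h x *\<^sub>R fs_grad E x)" B \<phi>0] h(4) by auto
  \<comment> \<open>Outside the nonzero tuples orthogonality holds because the cutoff vanishes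
    there.\<close>
  have orth: "y $ k \<bullet> (h y *\<^sub>R fs_grad E y) $ k = 0" for y k
    using fs_grad_orthogonal[of y k] h(2)[of y]
    by (cases "y \<in> nonzero_tuples") (auto simp: inner_eq_Re_braket braket_scaleR_right braket_def[of _ 0])
  have unit: "x t \<in> unit_tuples" if "t \<ge> 0" for t
  proof -
    have "norm (x t $ k) = 1" for k
    proof -
      have "((\<lambda>t. x t $ k \<bullet> x t $ k) has_derivative (\<lambda>_. 0)) (at s within {0..})" if "s \<ge> 0" for s
      proof -
        have "((\<lambda>t. x t $ k) has_derivative (\<lambda>r. (r *\<^sub>R - (h (x s) *\<^sub>R fs_grad E (x s))) $ k)) (at s within {0..})"
          using x(2)[OF that] unfolding has_vector_derivative_def
          by (rule bounded_linear.has_derivative[OF bounded_linear_vec_nth])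
        from has_derivative_inner[OF this this] show ?thesis
          by (rule has_derivative_eq_rhs)
            (use orth[of "x s" k] in \<open>auto simp: fun_eq_iff inner_commute\<close>)
      qed
      then have "x t $ k \<bullet> x t $ k = x 0 $ k \<bullet> x 0 $ k"
        using that by (intro has_derivative_zero_unique[of "{0..}" "\<lambda>t. x t $ k \<bullet> x t $ k" 0 t, symmetric]) auto
      then show ?thesis using assms x(1) by (simp add: norm_eq_sqrt_inner unit_tuples_def)
    qed
    then show ?thesis by (simp add: unit_tuples_def)
  qed
  have "NITE E (\<lambda>t. pt (x t))"
    unfolding NITE_def
  proof (intro exI[of _ x] allI impI conjI)
    fix t :: real assume "t \<ge> 0"
    then show "(x has_vector_derivative - fs_grad E (x t)) (at t within {0..})"
      using x(2)[of t] h(1)[OF unit] by simp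
  qed (use unit in auto)
  then show ?thesis using that x(1) by auto
qed

text \<open>\<open>f'\<close> is twice the inner product with \<open>fs_grad E\<close>, evaluated
  here at \<open>- fs_grad E\<close>. This factor 2 turns a gradient inequality with constant
  \<open>m\<close> into decay at rate \<open>2 * m\<close>.\<close>

lemma energy_derivative:
  assumes "x t \<in> nonzero_tuples" "(x has_vector_derivative - fs_grad E (x t)) (at t within S)"
  shows "((\<lambda>t. f (x t)) has_real_derivative - (2 * (norm (fs_grad E (x t)))\<^sup>2)) (at t within S)"
proof -
  have "((\<lambda>t. f (x t)) has_derivative (\<lambda>s. blinfun_apply (f' (x t)) (s *\<^sub>R - fs_grad E (x t)))) (at t within S)"
    using has_derivative_compose[OF assms(2)[unfolded has_vector_derivative_def]
        has_derivative_pullback[OF assms(1)]] by simp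
  then show ?thesis
    unfolding has_field_derivative_def
    by (rule has_derivative_eq_rhs)
      (simp add: fun_eq_iff f'_eq_fs_grad[OF assms(1)] power2_norm_eq_inner mult_ac)
qed

text \<open>Convexity with modulus \<open>m\<close> in the chart gives
  \<open>f \<phi> - f \<phi>0 \<le> f' (\<phi>0 + \<xi>) \<xi> - m |\<xi>|\<^sup>2 \<le> 2 |grad| |\<xi>| - m |\<xi>|\<^sup>2\<close>, and the right-hand side is at most
  \<open>|grad|\<^sup>2 / m\<close>. The rescaling from \<open>\<phi>0 + \<xi>\<close> back to the unit tuple \<open>\<phi>\<close> does not enlarge \<open>\<xi>\<close>.\<close>

lemma growth_and_gradient_inequality:
  assumes "CARD('d) \<ge> 2" and unit: "\<phi>0 \<in> unit_tuples" and crit: "f' \<phi>0 = 0"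
    and m: "0 < m" "m < lambda_min E \<phi>0"
  obtains r where "r > 0"
    "\<And>\<phi>. \<phi> \<in> unit_tuples \<Longrightarrow> norm (hproj \<phi>0 \<phi>) \<le> r \<Longrightarrow>
       f \<phi>0 + m * (norm (hproj \<phi>0 \<phi>))\<^sup>2 \<le> f \<phi>"
    "\<And>\<phi>. \<phi> \<in> unit_tuples \<Longrightarrow> norm (hproj \<phi>0 \<phi>) \<le> r \<Longrightarrow>
       m * (f \<phi> - f \<phi>0) \<le> (norm (fs_grad E \<phi>))\<^sup>2"
proof -
  have nz: "\<phi>0 \<in> nonzero_tuples" using unit unit_tuples_nonzero by blast
  have "isCont f'' \<phi>0"
    using continuous_f'' nz continuous_on_eq_continuous_at[OF open_nonzero_tuples] by blast
  \<comment> \<open>The tolerance is the gap between \<open>2 * lambda_min E \<phi>0\<close>, which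
    bounds \<open>f'' \<phi>0\<close> below on unit tangent vectors, and the bound
    \<open>2 * m\<close> wanted nearby.\<close>
  then obtain \<delta> where \<delta>: "\<delta> > 0"
    "\<And>x. dist x \<phi>0 < \<delta> \<Longrightarrow> dist (f'' x) (f'' \<phi>0) < 2 * (lambda_min E \<phi>0 - m)"
    using m unfolding continuous_at_eps_delta by (metis diff_gt_0_iff_gt mult_pos_pos zero_less_numeral)
  \<comment> \<open>The bound \<open>1 / 2\<close> admits the affine chart;
    \<open>\<delta> / 4\<close> leaves room for the factor 2 in the estimate of
    \<open>norm \<xi>\<close>.\<close>
  define r where "r = min (1 / 2) (\<delta> / 4)"
  have est: "f \<phi>0 + m * (norm (hproj \<phi>0 \<phi>))\<^sup>2 \<le> f \<phi>" "m * (f \<phi> - f \<phi>0) \<le> (norm (fs_grad E \<phi>))\<^sup>2"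
    if \<phi>: "\<phi> \<in> unit_tuples" and le: "norm (hproj \<phi>0 \<phi>) \<le> r" for \<phi>
  proof -
    obtain b \<xi> where b: "\<And>k. b k \<noteq> 0" "\<And>k. norm (b k) \<le> 1" and \<xi>: "\<xi> \<in> tangent \<phi>0"
      and \<phi>_eq: "\<phi> = rescale b (\<phi>0 + \<xi>)"
      and le\<xi>: "norm (hproj \<phi>0 \<phi>) \<le> norm \<xi>" and \<xi>le: "norm \<xi> \<le> 2 * norm (hproj \<phi>0 \<phi>)"
      using affine_chart[OF unit \<phi>] le by (auto simp: r_def)
    have \<xi>\<delta>: "norm \<xi> < \<delta>" using \<xi>le le \<delta>(1) by (auto simp: r_def)
    have seg: "\<phi>0 + t *\<^sub>R \<xi> \<in> nonzero_tuples" for t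
    proof -
      have "t *\<^sub>R \<xi> \<in> tangent \<phi>0" using \<xi> by (simp add: tangent_def braket_scaleR_right)
      from norm_add_tangent_ge[OF unit this] have "(\<phi>0 + t *\<^sub>R \<xi>) $ k \<noteq> 0" for k
        by (metis norm_zero not_one_le_zero)
      then show ?thesis unfolding nonzero_tuples_def by blast
    qed
    define u where "u t = f (\<phi>0 + t *\<^sub>R \<xi>)" for t
    define u' where "u' t = blinfun_apply (f' (\<phi>0 + t *\<^sub>R \<xi>)) \<xi>" for t
    define u'' where "u'' t = blinfun_apply (blinfun_apply (f'' (\<phi>0 + t *\<^sub>R \<xi>)) \<xi>) \<xi>" for t
    have dp: "((\<lambda>t. \<phi>0 + t *\<^sub>R \<xi>) has_derivative (\<lambda>s. s *\<^sub>R \<xi>)) (at t)" for t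
      by (auto intro!: derivative_eq_intros)
    have du: "(u has_real_derivative u' t) (at t)" for t
      using has_derivative_compose[OF dp has_derivative_pullback[OF seg], of t]
      by (simp add: has_field_derivative_def u_def[abs_def] u'_def blinfun.scaleR_right mult_commute_abs)
    have du': "(u' has_real_derivative u'' t) (at t)" for t
    proof -
      have "((\<lambda>t. f' (\<phi>0 + t *\<^sub>R \<xi>)) has_derivative (\<lambda>s. blinfun_apply (f'' (\<phi>0 + t *\<^sub>R \<xi>)) (s *\<^sub>R \<xi>))) (at t)"
        by (rule has_derivative_compose[OF dp has_derivative_f'[OF seg]])
      then have "(u' has_derivative (\<lambda>s. blinfun_apply (blinfun_apply (f'' (\<phi>0 + t *\<^sub>R \<xi>)) (s *\<^sub>R \<xi>)) \<xi>)) (at t)"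
        unfolding u'_def[abs_def] by (rule bounded_linear.has_derivative[OF blinfun.bounded_linear_left])
      then show ?thesis
        by (simp add: has_field_derivative_def u''_def blinfun.scaleR_right blinfun.scaleR_left mult_commute_abs)
    qed
    \<comment> \<open>Along the whole segment the direction is the same \<open>\<xi>\<close>,
      tangent at \<open>\<phi>0\<close>, so \<open>lambda_min\<close> bounds
      \<open>f'' \<phi>0\<close> and only the difference \<open>D\<close> remains to be
      controlled.\<close>
    have cvx: "2 * (m * (norm \<xi>)\<^sup>2) \<le> u'' t" if t: "0 \<le> t" "t \<le> 1" for t
    proof -
      define y where "y = \<phi>0 + t *\<^sub>R \<xi>"
      define D where "D = f'' y - f'' \<phi>0"
      have "dist y \<phi>0 \<le> 1 * norm \<xi>"
        using t by (simp add: y_def dist_norm mult_left_le_one_le)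
      then have D: "norm D \<le> 2 * (lambda_min E \<phi>0 - m)"
        using \<delta>(2)[of y] \<xi>\<delta> by (simp add: D_def dist_norm)
      have "\<bar>blinfun_apply (blinfun_apply D \<xi>) \<xi>\<bar> \<le> norm (blinfun_apply D \<xi>) * norm \<xi>"
        unfolding real_norm_def[symmetric] by (rule norm_blinfun)
      also have "\<dots> \<le> norm D * norm \<xi> * norm \<xi>"
        by (intro mult_right_mono norm_blinfun) auto
      also have "\<dots> \<le> 2 * (lambda_min E \<phi>0 - m) * norm \<xi> * norm \<xi>"
        by (intro mult_right_mono D) auto
      finally have "\<bar>blinfun_apply (blinfun_apply D \<xi>) \<xi>\<bar> \<le> 2 * (lambda_min E \<phi>0 - m) * (norm \<xi>)\<^sup>2"
        by (simp add: power2_eq_square mult_ac)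
      moreover have "u'' t = blinfun_apply (blinfun_apply (f'' \<phi>0) \<xi>) \<xi> + blinfun_apply (blinfun_apply D \<xi>) \<xi>"
        by (simp add: u''_def D_def y_def blinfun.diff_left)
      ultimately show ?thesis
        using lambda_min_le[OF assms(1) nz \<xi>] by (simp add: algebra_simps)
    qed
    note taylor = taylor_lower_bounds[of u u' u'', OF du du' cvx]
    have u0: "u 0 = f \<phi>0" "u' 0 = 0" by (simp_all add: u_def u'_def crit)
    have u1: "u 1 = f \<phi>" unfolding \<phi>_eq pullback_rescale[OF b(1)] by (simp add: u_def)
    have "f \<phi>0 + m * (norm \<xi>)\<^sup>2 \<le> f \<phi>" using taylor(1) u0 u1 by simp
    moreover have "m * (norm (hproj \<phi>0 \<phi>))\<^sup>2 \<le> m * (norm \<xi>)\<^sup>2"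
      using m le\<xi> by (intro mult_left_mono power_mono) auto
    ultimately show "f \<phi>0 + m * (norm (hproj \<phi>0 \<phi>))\<^sup>2 \<le> f \<phi>" by linarith
    define g where "g = norm (fs_grad E \<phi>)"
    \<comment> \<open>The Taylor bound ends at \<open>\<phi>0 + \<xi>\<close>, whereas the gradient
      is wanted at \<open>\<phi>\<close>; \<open>f'_rescale\<close> moves the derivative
      there.\<close>
    have "u' 1 = blinfun_apply (f' \<phi>) (rescale b \<xi>)"
      using f'_rescale[of "\<phi>0 + \<xi>" b \<xi>] seg[of 1] b by (simp add: u'_def \<phi>_eq)
    also have "\<dots> = 2 * (fs_grad E \<phi> \<bullet> rescale b \<xi>)"
      using \<phi> unit_tuples_nonzero by (intro f'_eq_fs_grad) auto
    also have "\<dots> \<le> 2 * (g * norm (rescale b \<xi>))"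
      unfolding g_def by (intro mult_left_mono norm_cauchy_schwarz) auto
    also have "\<dots> \<le> 2 * (g * norm \<xi>)"
      by (intro mult_left_mono norm_rescale_le b) (auto simp: g_def)
    finally have "f \<phi> - f \<phi>0 \<le> 2 * (g * norm \<xi>) - m * (norm \<xi>)\<^sup>2"
      using taylor(2) u0 u1 by simp
    then have "m * (f \<phi> - f \<phi>0) \<le> m * (2 * (g * norm \<xi>) - m * (norm \<xi>)\<^sup>2)"
      using m by (intro mult_left_mono) auto
    \<comment> \<open>Completing the square eliminates the length of \<open>\<xi>\<close>.\<close>
    also have "\<dots> = g\<^sup>2 - (g - m * norm \<xi>)\<^sup>2" by (simp add: power2_eq_square algebra_simps)
    also have "\<dots> \<le> g\<^sup>2" by simp
    finally show "m * (f \<phi> - f \<phi>0) \<le> (norm (fs_grad E \<phi>))\<^sup>2" unfolding g_def .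
  qed
  show ?thesis using est \<delta>(1) by (intro that[of r]) (auto simp: r_def)
qed

text \<open>On the boundary of \<open>{\<phi>. norm (hproj \<phi>0 \<phi>) \<le> r}\<close> the energy is at least \<open>f \<phi>0 + m r\<^sup>2\<close>, and it
  decreases along trajectories, so they cannot leave through the boundary.\<close>

lemma trajectory_decay:
  assumes m: "m > 0" and r: "r > 0"
    and growth: "\<And>\<phi>. \<phi> \<in> unit_tuples \<Longrightarrow> norm (hproj \<phi>0 \<phi>) \<le> r \<Longrightarrow>
       f \<phi>0 + m * (norm (hproj \<phi>0 \<phi>))\<^sup>2 \<le> f \<phi>"
    and gradient: "\<And>\<phi>. \<phi> \<in> unit_tuples \<Longrightarrow> norm (hproj \<phi>0 \<phi>) \<le> r \<Longrightarrow>
       m * (f \<phi> - f \<phi>0) \<le> (norm (fs_grad E \<phi>))\<^sup>2"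
    and unit: "\<And>t. t \<ge> 0 \<Longrightarrow> x t \<in> unit_tuples"
    and flow: "\<And>t. t \<ge> 0 \<Longrightarrow> (x has_vector_derivative - fs_grad E (x t)) (at t within {0..})"
    and init: "norm (hproj \<phi>0 (x 0)) < r" "f (x 0) < f \<phi>0 + m * r\<^sup>2"
    and t: "t \<ge> 0"
  shows "f (x t) - f \<phi>0 \<le> exp (- (2 * m) * t) * (f (x 0) - f \<phi>0)"
proof -
  have nz: "x t \<in> nonzero_tuples" if "t \<ge> 0" for t using unit[OF that] unit_tuples_nonzero by blast
  have df: "((\<lambda>t. f (x t)) has_real_derivative - (2 * (norm (fs_grad E (x t)))\<^sup>2)) (at t within {0..})"
    if "t \<ge> 0" for t
    by (rule energy_derivative[OF nz[OF that] flow[OF that]])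
  have interior: "at s within {0..} = at s" if "s > 0" for s :: real
    by (rule at_within_interior) (use that in simp)
  have cont_f: "continuous_on {0..} (\<lambda>t. f (x t))"
    unfolding continuous_on_eq_continuous_within by (metis DERIV_continuous[OF df] atLeast_iff)
  have dec: "f (x s) \<le> f (x 0)" if "s \<ge> 0" for s
  proof (rule DERIV_nonpos_imp_decreasing_open[OF that])
    show "\<exists>y. ((\<lambda>t. f (x t)) has_real_derivative y) (at u) \<and> y \<le> 0" if "0 < u" "u < s" for u
      using df[of u] that interior[of u] by (intro exI conjI) auto
    show "continuous_on {0..s} (\<lambda>t. f (x t))" by (rule continuous_on_subset[OF cont_f]) auto
  qed
  define \<rho> where "\<rho> t = norm (hproj \<phi>0 (x t))" for t
  have "continuous_on {0..} x"
    unfolding continuous_on_eq_continuous_within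
    by (metis has_vector_derivative_continuous[OF flow] atLeast_iff)
  then have cont_\<rho>: "continuous_on {0..} \<rho>"
    unfolding \<rho>_def
    by (intro continuous_on_norm linear_continuous_on_compose[OF _ linear_hproj])
  \<comment> \<open>By the intermediate value theorem, leaving requires a time with
    \<open>\<rho> u = r\<close>, where \<open>growth\<close> still applies because its hypothesis is
    not strict.\<close>
  have trap: "\<rho> s \<le> r" if s: "s \<ge> 0" for s
  proof (rule ccontr)
    assume "\<not> \<rho> s \<le> r"
    moreover have "continuous_on {0..s} \<rho>" by (rule continuous_on_subset[OF cont_\<rho>]) auto
    moreover have "\<rho> 0 \<le> r" using init(1) by (simp add: \<rho>_def)
    ultimately obtain u where u: "0 \<le> u" "\<rho> u = r"
      using IVT'[of \<rho> 0 r s] s by auto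
    then have "f \<phi>0 + m * r\<^sup>2 \<le> f (x u)"
      using growth[OF unit[OF u(1)]] by (simp add: \<rho>_def)
    then show False using dec[OF u(1)] init(2) by simp
  qed
  \<comment> \<open>The weight turns the claim into monotonicity of \<open>y\<close>, whose
    derivative is nonpositive by the gradient inequality.\<close>
  define y where "y s = (f (x s) - f \<phi>0) * exp (2 * m * s)" for s
  have "y t \<le> y 0"
  proof (rule DERIV_nonpos_imp_decreasing_open[OF t])
    fix s :: real assume s: "0 < s" "s < t"
    have "((\<lambda>t. f (x t)) has_real_derivative - (2 * (norm (fs_grad E (x s)))\<^sup>2)) (at s)"
      using df[of s] s interior[of s] by simp
    then have "(y has_real_derivative
        2 * (m * (f (x s) - f \<phi>0) - (norm (fs_grad E (x s)))\<^sup>2) * exp (2 * m * s)) (at s)"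
      unfolding y_def by (auto intro!: derivative_eq_intros simp: algebra_simps)
    moreover have "2 * (m * (f (x s) - f \<phi>0) - (norm (fs_grad E (x s)))\<^sup>2) * exp (2 * m * s) \<le> 0"
    proof (rule mult_nonpos_nonneg)
      have "m * (f (x s) - f \<phi>0) \<le> (norm (fs_grad E (x s)))\<^sup>2"
        using s trap[of s] by (intro gradient unit) (simp_all add: \<rho>_def)
      then show "2 * (m * (f (x s) - f \<phi>0) - (norm (fs_grad E (x s)))\<^sup>2) \<le> 0" by simp
    qed simp
    ultimately show "\<exists>d. (y has_real_derivative d) (at s) \<and> d \<le> 0" by blast
  next
    show "continuous_on {0..t} y"
      unfolding y_def by (intro continuous_intros continuous_on_subset[OF cont_f]) auto
  qed
  then show ?thesis by (simp add: y_def exp_minus field_simps)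
qed

end

theorem theorem1:
  fixes E :: "('d::finite) cproj ^ ('k::finite) \<Rightarrow> real"
    and \<phi>s :: "(complex ^ 'd) ^ 'k"
    and \<mu> :: real
  assumes "CARD('d) \<ge> 2" and "CARD('k) \<ge> 1"
    and "C2_manifold E"
    and "\<phi>s \<in> unit_tuples"
    and "nondegenerate_local_min E \<phi>s"
    and "lambda_min E \<phi>s > 0"
    and "0 < \<mu>" and "\<mu> < 2 * lambda_min E \<phi>s"
  shows "\<exists>V. open V \<and> pt \<phi>s \<in> V \<and>
    (\<forall>p\<in>V.
      (\<exists>c. NITE E c \<and> c 0 = p) \<and>
      (\<forall>c. NITE E c \<and> c 0 = p \<longrightarrow>
        (\<forall>t\<ge>0. E (c t) - E (pt \<phi>s) \<le> exp (- \<mu> * t) * (E p - E (pt \<phi>s)))))"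
proof -
  obtain f' f'' where "C2_energy E f' f''"
    using assms(3) unfolding C2_manifold_def C2_on_def C2_energy_def by blast
  then interpret C2_energy E f' f'' .
  \<comment> \<open>Halved because the energy decays at twice the constant of the gradient
    inequality.\<close>
  define m where "m = \<mu> / 2"
  have m: "0 < m" "m < lambda_min E \<phi>s" using assms(7,8) by (auto simp: m_def)
  have nz: "\<phi>s \<in> nonzero_tuples" using assms(4) unit_tuples_nonzero by blast
  have "f' \<phi>s = 0"
    using assms(5) by (intro pullback_critical nz) (simp add: nondegenerate_local_min_def)
  from growth_and_gradient_inequality[OF assms(1,4) this m] obtain r where r: "r > 0"
    and growth: "\<And>\<phi>. \<phi> \<in> unit_tuples \<Longrightarrow> norm (hproj \<phi>s \<phi>) \<le> r \<Longrightarrow>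
       f \<phi>s + m * (norm (hproj \<phi>s \<phi>))\<^sup>2 \<le> f \<phi>"
    and gradient: "\<And>\<phi>. \<phi> \<in> unit_tuples \<Longrightarrow> norm (hproj \<phi>s \<phi>) \<le> r \<Longrightarrow>
       m * (f \<phi> - f \<phi>s) \<le> (norm (fs_grad E \<phi>))\<^sup>2"
    by blast
  \<comment> \<open>The strict initial conditions of \<open>trajectory_decay\<close>, imposed on
    nonzero tuples to obtain an open set of the ambient space.\<close>
  define W where "W = {\<phi> \<in> nonzero_tuples. norm (hproj \<phi>s \<phi>) < r \<and> f \<phi> < f \<phi>s + m * r\<^sup>2}"
  have "open W"
  proof -
    have "continuous_on nonzero_tuples f"
      by (meson continuous_at_imp_continuous_on has_derivative_continuous has_derivative_pullback)
    then have "open (nonzero_tuples \<inter> f -` {..<f \<phi>s + m * r\<^sup>2})"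
      by (intro continuous_open_preimage open_nonzero_tuples open_lessThan)
    moreover have "open {\<phi>. norm (hproj \<phi>s \<phi>) < r}"
      by (intro open_Collect_less continuous_on_norm linear_continuous_on_compose[OF _ linear_hproj]
          continuous_intros)
    ultimately have "open ((nonzero_tuples \<inter> f -` {..<f \<phi>s + m * r\<^sup>2}) \<inter> {\<phi>. norm (hproj \<phi>s \<phi>) < r})"
      by (rule open_Int)
    also have "\<dots> = W" by (auto simp: W_def)
    finally show ?thesis .
  qed
  have "hproj \<phi>s \<phi>s = 0"
    using assms(4) by (simp add: hproj_def vec_eq_iff braket_self unit_tuples_def)
  then have "\<phi>s \<in> W" using nz r m by (simp add: W_def)
  have "(\<exists>c. NITE E c \<and> c 0 = pt \<phi>) \<and> (\<forall>c. NITE E c \<and> c 0 = pt \<phi> \<longrightarrow>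
        (\<forall>t\<ge>0. E (c t) - E (pt \<phi>s) \<le> exp (- \<mu> * t) * (E (pt \<phi>) - E (pt \<phi>s))))"
    if \<phi>: "\<phi> \<in> W" "\<phi> \<in> unit_tuples" for \<phi>
  proof (intro conjI allI impI)
    show "\<exists>c. NITE E c \<and> c 0 = pt \<phi>" using NITE_exists[OF \<phi>(2)] by metis
    fix c and t :: real assume c: "NITE E c \<and> c 0 = pt \<phi>" and t: "t \<ge> 0"
    then obtain x where x: "\<And>t. t \<ge> 0 \<Longrightarrow> x t \<in> unit_tuples" "\<And>t. t \<ge> 0 \<Longrightarrow> c t = pt (x t)"
      "\<And>t. t \<ge> 0 \<Longrightarrow> (x has_vector_derivative - fs_grad E (x t)) (at t within {0..})"
      unfolding NITE_def by blast
    \<comment> \<open>The lift \<open>x\<close> may start at other phases than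
      \<open>\<phi>\<close>; both inequalities in \<open>W\<close> are invariant under such a
      change.\<close>
    have x0: "pt (x 0) = pt \<phi>" using c x(2)[of 0] by simp
    then obtain b where "\<And>k. norm (b k) = 1" "x 0 = rescale b \<phi>"
      using pt_eq_unit_tuplesE[of \<phi> "x 0"] x(1)[of 0] \<phi>(2) by auto
    then have "norm (hproj \<phi>s (x 0)) = norm (hproj \<phi>s \<phi>)"
      by (simp add: hproj_rescale norm_rescale_unit)
    then have "f (x t) - f \<phi>s \<le> exp (- (2 * m) * t) * (f (x 0) - f \<phi>s)"
      using \<phi>(1) x0 by (intro trajectory_decay[OF m(1) r growth gradient x(1,3) _ _ t]) (auto simp: W_def)
    then show "E (c t) - E (pt \<phi>s) \<le> exp (- \<mu> * t) * (E (pt \<phi>) - E (pt \<phi>s))"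
      using x(2)[OF t] x0 by (simp add: m_def)
  qed
  then show ?thesis
    using open_pt_image[OF \<open>open W\<close>] \<open>\<phi>s \<in> W\<close> assms(4)
    by (intro exI[of _ "pt ` (W \<inter> unit_tuples)"]) auto
qed

end
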